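(* Let $f,h_i,g_j:\mathbb{R}^n\to\mathbb{R}$ ($i\in\mathcal{E}=\{1,\dots,m\}$, $j\in\mathcal{I}=\{1,\dots,p\}$) be twice continuously differentiable, and let $x^*$ be a local minimizer of the problem of minimizing $f(x)$ subject to $h_i(x)=0$ for all $i\in\mathcal{E}$ and $g_j(x)\le 0$ for all $j\in\mathcal{I}$. Assume that the Mangasarian-Fromovitz Constraint Qualification (MFCQ) holds at $x^*$. Let $r$ be the rank of $J(x^* )$, and assume that for every $x$ in some neighborhood of $x^*$ the rank of $J(x)$ is at most $r+1$. Suppose also that the smooth singular value decomposition assumption (stated in the context) holds for $J$ around $x^*$. Then there is a Lagrange multiplier $(\lambda,\mu)$ such that the weak second-order optimality condition (WSOC) holds at $x^*$, that is, there exists $(\lambda,\mu)\in\Lambda(x^* )$ such that $d^{\mathtt{T}}\nabla^2_{xx}L(x^*,\lambda,\mu)d\ge 0$ for every $d\in S(x^* )$.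
   Context: The active set at a feasible point $x^*$ is $A(x^* )=\{j\in\mathcal{I}: g_j(x^* )=0\}$, and $q=|A(x^* )|$. MFCQ holds at a feasible point $x^*$ if $\{\nabla h_i(x^* ): i\in\mathcal{E}\}$ is linearly independent and there is $d\in\mathbb{R}^n$ with $\nabla h_i(x^* )^{\mathtt{T}}d=0$ for all $i\in\mathcal{E}$ and $\nabla g_j(x^* )^{\mathtt{T}}d<0$ for all $j\in A(x^* )$. For $x\in\mathbb{R}^n$, $J(x)\in\mathbb{R}^{(m+q)\times n}$ is the matrix whose first $m$ rows are $\nabla h_i(x)^{\mathtt{T}}$, $i\in\mathcal{E}$, and whose remaining rows are $\nabla g_j(x)^{\mathtt{T}}$, $j\in A(x^* )$ (the index set $A(x^* )$ is kept fixed as $x$ varies). Smooth singular value decomposition assumption: there exist functions, differentiable around $x^*$, $x\mapsto U(x)\in\mathbb{R}^{(m+q)\times(m+q)}$, $x\mapsto\Sigma(x)\in\mathbb{R}^{(m+q)\times n}$ and $x\mapsto V(x)\in\mathbb{R}^{n\times n}$, such that $J(x)=U(x)\Sigma(x)V(x)^{\mathtt{T}}$ for $x$ near $x^*$, where $\Sigma(x)$ is diagonal with diagonal elements $\sigma_1(x),\dots,\sigma_k(x)$, $k=\min\{m+q,n\}$, and $\sigma_i(x)=0$ whenever $i$ is greater than the rank of $J(x)$; moreover, $U(x^* )$ and $V(x^* )$ are matrices with non-zero, (pairwise) orthogonal columns. (Orthogonality of columns is required only at $x=x^*$; columns need not be normalized, and the $\sigma_i(x)$ need not be non-negative or ordered.)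 The Lagrangian is $L(x,\lambda,\mu)=f(x)+\sum_{i=1}^m\lambda_i h_i(x)+\sum_{j=1}^p\mu_j g_j(x)$; $\nabla_x L$ and $\nabla^2_{xx}L$ denote its gradient and Hessian with respect to $x$. The set of Lagrange multipliers at $x^*$ is $\Lambda(x^* )=\{(\lambda,\mu)\in\mathbb{R}^m\times\mathbb{R}^p_+ : \nabla_x L(x^*,\lambda,\mu)=0,\ \mu_j g_j(x^* )=0\ \forall j\in\mathcal{I}\}$. The critical subspace is $S(x^* )=\{d\in\mathbb{R}^n : \nabla h_i(x^* )^{\mathtt{T}}d=0\ \forall i\in\mathcal{E},\ \nabla g_j(x^* )^{\mathtt{T}}d=0\ \forall j\in A(x^* )\}$. *)

theory Defs
  imports "HOL-Analysis.Analysis" "Jordan_Normal_Form.DL_Rank"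
begin

text \<open>
  Both HOL-Analysis and Jordan_Normal_Form are used: points, gradients and Hessians live in
  \<open>real ^ 'n\<close>, whereas matrices of size \<open>(m + q) \<times> n\<close>, whose number of rows depends on the active
  set, are of type \<open>real Matrix.mat\<close>. Constraint indices start at 0: the equality constraints are
  \<open>h i\<close> for \<open>i < m\<close>, the inequality constraints \<open>g j\<close> for \<open>j < p\<close> (either number may be 0), and
  the values of \<open>h\<close>, \<open>g\<close> and of multipliers at other indices are irrelevant.
\<close>

no_notation Matrix.vec_index (infixl "$" 100)
no_notation Matrix.scalar_prod (infix "\<bullet>" 70)

definition grad :: "(real ^ 'n \<Rightarrow> real) \<Rightarrow> real ^ 'n \<Rightarrow> real ^ 'n" where
  "grad F x = (THE D. GDERIV F x :> D)"

definition hessian :: "(real ^ 'n \<Rightarrow> real) \<Rightarrow> real ^ 'n \<Rightarrow> real ^ 'n ^ 'n" where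
  "hessian F x = jacobian (grad F) (at x)"

definition twice_cont_diff :: "(real ^ 'n \<Rightarrow> real) \<Rightarrow> bool" where
  "twice_cont_diff F \<longleftrightarrow>
     (\<forall>x. F differentiable (at x)) \<and>
     (\<forall>x. grad F differentiable (at x)) \<and>
     continuous_on UNIV (hessian F)"

definition feasible_set ::
  "nat \<Rightarrow> nat \<Rightarrow> (nat \<Rightarrow> real ^ 'n \<Rightarrow> real) \<Rightarrow> (nat \<Rightarrow> real ^ 'n \<Rightarrow> real) \<Rightarrow> (real ^ 'n) set" where
  "feasible_set m p h g = {x. (\<forall>i<m. h i x = 0) \<and> (\<forall>j<p. g j x \<le> 0)}"

definition local_minimizer_on :: "(real ^ 'n \<Rightarrow> real) \<Rightarrow> (real ^ 'n) set \<Rightarrow> real ^ 'n \<Rightarrow> bool" where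
  "local_minimizer_on F S x \<longleftrightarrow> x \<in> S \<and> (\<forall>\<^sub>F y in nhds x. y \<in> S \<longrightarrow> F x \<le> F y)"

definition active_set :: "nat \<Rightarrow> (nat \<Rightarrow> real ^ 'n \<Rightarrow> real) \<Rightarrow> real ^ 'n \<Rightarrow> nat set" where
  "active_set p g x = {j. j < p \<and> g j x = 0}"

text \<open>
  The gradients of the equality constraints are required to be independent as an indexed family,
  so a repeated gradient counts as a dependency; hence the injectivity.
\<close>

definition MFCQ ::
  "nat \<Rightarrow> nat \<Rightarrow> (nat \<Rightarrow> real ^ 'n \<Rightarrow> real) \<Rightarrow> (nat \<Rightarrow> real ^ 'n \<Rightarrow> real) \<Rightarrow> real ^ 'n \<Rightarrow> bool" where
  "MFCQ m p h g x \<longleftrightarrow>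
     x \<in> feasible_set m p h g \<and>
     inj_on (\<lambda>i. grad (h i) x) {..<m} \<and>
     independent ((\<lambda>i. grad (h i) x) ` {..<m}) \<and>
     (\<exists>d. (\<forall>i<m. inner (grad (h i) x) d = 0) \<and>
          (\<forall>j\<in>active_set p g x. inner (grad (g j) x) d < 0))"

text \<open>
  Column \<open>k\<close> of the matrix is the coordinate \<open>from_nat_into UNIV k\<close> of \<open>real ^ 'n\<close>, where
  \<open>from_nat_into UNIV\<close> is a bijection from \<open>{..<CARD('n)}\<close> to the index type \<open>'n\<close>; the rows
  belonging to the (fixed) index set \<open>A\<close> are in increasing order of index. Neither ordering
  matters for the rank or for the existence of the decomposition below: permuting the rows or
  columns of \<open>J\<close> amounts to permuting the rows of \<open>U\<close> or \<open>V\<close>.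
\<close>

definition constraint_jacobian ::
  "nat \<Rightarrow> nat set \<Rightarrow> (nat \<Rightarrow> real ^ 'n \<Rightarrow> real) \<Rightarrow> (nat \<Rightarrow> real ^ 'n \<Rightarrow> real) \<Rightarrow>
    real ^ 'n \<Rightarrow> real Matrix.mat" where
  "constraint_jacobian m A h g x =
     Matrix.mat (m + card A) CARD('n)
       (\<lambda>(i, k). (if i < m then grad (h i) x else grad (g (sorted_list_of_set A ! (i - m))) x)
                   $ from_nat_into UNIV k)"

definition mat_rank :: "real Matrix.mat \<Rightarrow> nat" where
  "mat_rank M = vec_space.rank (dim_row M) M"

definition differentiable_near ::
  "nat \<Rightarrow> nat \<Rightarrow> (real ^ 'n \<Rightarrow> real Matrix.mat) \<Rightarrow> real ^ 'n \<Rightarrow> bool" where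
  "differentiable_near nr nc M x \<longleftrightarrow>
     (\<forall>y. M y \<in> carrier_mat nr nc) \<and>
     (\<forall>\<^sub>F y in nhds x. \<forall>i<nr. \<forall>k<nc. (\<lambda>z. M z $$ (i, k)) differentiable (at y))"

definition nonzero_orthogonal_cols :: "real Matrix.mat \<Rightarrow> bool" where
  "nonzero_orthogonal_cols M \<longleftrightarrow>
     (\<forall>i<dim_col M. col M i \<noteq> 0\<^sub>v (dim_row M)) \<and>
     (\<forall>i<dim_col M. \<forall>j<dim_col M. i \<noteq> j \<longrightarrow> scalar_prod (col M i) (col M j) = 0)"

text \<open>
  With 0-based indices, the diagonal element \<open>\<sigma>\<^sub>i\<close> is the entry \<open>(i - 1, i - 1)\<close>, so \<open>\<sigma>\<^sub>i\<close> with
  \<open>i\<close> greater than the rank is an entry \<open>(l, l)\<close> with \<open>l\<close> at least the rank.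
\<close>

definition smooth_svd ::
  "nat \<Rightarrow> nat \<Rightarrow> (real ^ 'n \<Rightarrow> real Matrix.mat) \<Rightarrow> real ^ 'n \<Rightarrow> bool" where
  "smooth_svd nr nc J x \<longleftrightarrow>
     (\<exists>U \<Sigma> V.
        differentiable_near nr nr U x \<and>
        differentiable_near nr nc \<Sigma> x \<and>
        differentiable_near nc nc V x \<and>
        (\<forall>\<^sub>F y in nhds x.
           J y = U y * \<Sigma> y * transpose_mat (V y) \<and>
           diagonal_mat (\<Sigma> y) \<and>
           (\<forall>l < min nr nc. mat_rank (J y) \<le> l \<longrightarrow> \<Sigma> y $$ (l, l) = 0)) \<and>
        nonzero_orthogonal_cols (U x) \<and>
        nonzero_orthogonal_cols (V x))"

definition lagrangian ::
  "nat \<Rightarrow> nat \<Rightarrow> (real ^ 'n \<Rightarrow> real) \<Rightarrow> (nat \<Rightarrow> real ^ 'n \<Rightarrow> real) \<Rightarrow> (nat \<Rightarrow> real ^ 'n \<Rightarrow> real) \<Rightarrow>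
    (nat \<Rightarrow> real) \<Rightarrow> (nat \<Rightarrow> real) \<Rightarrow> real ^ 'n \<Rightarrow> real" where
  "lagrangian m p f h g lam mu x = f x + (\<Sum>i<m. lam i * h i x) + (\<Sum>j<p. mu j * g j x)"

definition lagrange_multipliers ::
  "nat \<Rightarrow> nat \<Rightarrow> (real ^ 'n \<Rightarrow> real) \<Rightarrow> (nat \<Rightarrow> real ^ 'n \<Rightarrow> real) \<Rightarrow> (nat \<Rightarrow> real ^ 'n \<Rightarrow> real) \<Rightarrow>
    real ^ 'n \<Rightarrow> ((nat \<Rightarrow> real) \<times> (nat \<Rightarrow> real)) set" where
  "lagrange_multipliers m p f h g x =
     {(lam, mu). (\<forall>j<p. 0 \<le> mu j) \<and>
               grad (lagrangian m p f h g lam mu) x = 0 \<and>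
               (\<forall>j<p. mu j * g j x = 0)}"

definition critical_subspace ::
  "nat \<Rightarrow> nat \<Rightarrow> (nat \<Rightarrow> real ^ 'n \<Rightarrow> real) \<Rightarrow> (nat \<Rightarrow> real ^ 'n \<Rightarrow> real) \<Rightarrow> real ^ 'n \<Rightarrow>
    (real ^ 'n) set" where
  "critical_subspace m p h g x =
     {d. (\<forall>i<m. inner (grad (h i) x) d = 0) \<and>
         (\<forall>j\<in>active_set p g x. inner (grad (g j) x) d = 0)}"

end

theory Submission
  imports Defs
begin

text \<open>
  Write \<open>c\<^sub>i\<close> for the equality and active inequality constraints. If \<open>w\<close> is the difference of two
  multipliers, then \<open>w\<^sup>T J(xs) = 0\<close>, and for \<open>d\<close> in the critical subspace \<open>J(xs) d = 0\<close>. Differentiating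
  \<open>w\<^sup>T J d = w\<^sup>T U \<Sigma> V\<^sup>T d\<close> at \<open>xs\<close> in direction \<open>d\<close> with \<open>w\<close> and \<open>d\<close> fixed, all singular values but the one with
  (0-based) index \<open>r\<close>, the rank of \<open>J(xs)\<close>, drop out, so that
  \<open>\<Sum>\<^sub>i w\<^sub>i d\<^sup>T\<nabla>\<^sup>2c\<^sub>i d = \<tau>(w) \<rho>(d)\<close> with \<open>\<tau>\<close> linear. Hence on the critical subspace the Hessians
  of the Lagrangian for all multipliers depend on the one parameter \<open>\<tau>\<close> only. By MFCQ the set of
  multipliers is compact, and for every critical direction some multiplier gives a nonnegative
  value; by affinity this can be taken to be one of the two multipliers extremal for \<open>\<tau>\<close>. Yuan's
  lemma then yields a convex combination of these two that works for all directions.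
\<close>

section \<open>Theorems of the alternative\<close>

text \<open>If every \<open>s\<close> in the unit interval failed, the parameters at which
  \<open>F s\<close> is negative somewhere on \<open>0 \<le> P\<close>, respectively on
  \<open>0 \<le> N\<close>, would form open sets \<open>A\<close> and \<open>B\<close> covering this
  connected interval, each meeting it. A common \<open>s\<close> yields two directions; on the
  segment joining them, after a possible sign change, \<open>F s\<close> stays negative, yet it
  contains a point with \<open>P = N = F s\<close>, where both forms are negative.\<close>

lemma yuan_lemma:
  fixes P N :: "'a::real_vector \<Rightarrow> 'a \<Rightarrow> real"
  assumes P: "bilinear P" and N: "bilinear N" and S: "Real_Vector_Spaces.subspace S"
    and nonneg: "\<And>d. d \<in> S \<Longrightarrow> 0 \<le> P d d \<or> 0 \<le> N d d"
  shows "\<exists>s\<in>{0..1}. \<forall>d\<in>S. 0 \<le> (1 - s) * P d d + s * N d d"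
proof (rule ccontr)
  assume contra: "\<not> ?thesis"
  define F where "F s u v = (1 - s) * P u v + s * N u v" for s u v
  define A where "A = {s. \<exists>d\<in>S. 0 \<le> P d d \<and> F s d d < 0}"
  define B where "B = {s. \<exists>d\<in>S. 0 \<le> N d d \<and> F s d d < 0}"
  have A_Union: "A = (\<Union>d\<in>{d\<in>S. 0 \<le> P d d}. {s. F s d d < 0})"
    and B_Union: "B = (\<Union>d\<in>{d\<in>S. 0 \<le> N d d}. {s. F s d d < 0})"
    unfolding A_def B_def by auto
  have "open {s. F s d d < 0}" for d
    unfolding F_def by (intro open_Collect_less continuous_intros)
  then have "open A" "open B"
    unfolding A_Union B_Union by auto
  have neg: "\<exists>d\<in>S. F s d d < 0" if "s \<in> {0..1}" for s
    using contra that unfolding F_def by (force simp: not_le)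
  then have cover: "{0..1} \<subseteq> A \<union> B"
    using nonneg unfolding A_def B_def by blast
  \<comment> \<open>\<open>F 0\<close> is \<open>P\<close>, so at this \<open>d\<close> the form
    \<open>N\<close> must be the nonnegative one; at \<open>1\<close> the roles are
    exchanged.\<close>
  obtain d where "d \<in> S" "F 0 d d < 0"
    using neg[of 0] by auto
  then have "0 \<in> B"
    using nonneg unfolding B_def by (fastforce simp: F_def)
  obtain d where "d \<in> S" "F 1 d d < 0"
    using neg[of 1] by auto
  then have "1 \<in> A"
    using nonneg unfolding A_def by (fastforce simp: F_def)
  have "A \<inter> B \<inter> {0..1} \<noteq> {}"
    using connectedD[OF connected_Icc[of 0 "1::real"] \<open>open A\<close> \<open>open B\<close> _ cover]
      disjoint_iff[of A "{0..1}"] disjoint_iff[of B "{0..1}"] \<open>0 \<in> B\<close> \<open>1 \<in> A\<close> by force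
  then obtain s where s: "0 \<le> s" "s \<le> 1" "s \<in> A" "s \<in> B"
    by auto
  obtain d1 where d1: "d1 \<in> S" "0 \<le> P d1 d1" "F s d1 d1 < 0"
    using s(3) unfolding A_def by auto
  obtain d0 where d0: "d0 \<in> S" "0 \<le> N d0 d0" "F s d0 d0 < 0"
    using s(4) unfolding B_def by auto
  note bil = bilinear_ladd[OF P] bilinear_radd[OF P] bilinear_lmul[OF P] bilinear_rmul[OF P]
    bilinear_lneg[OF P] bilinear_rneg[OF P]
    bilinear_ladd[OF N] bilinear_radd[OF N] bilinear_lmul[OF N] bilinear_rmul[OF N]
    bilinear_lneg[OF N] bilinear_rneg[OF N]
  \<comment> \<open>This sign keeps \<open>F s\<close> negative along the segment from \<open>d1\<close> to \<open>d2\<close>, which crosses \<open>P = N\<close>.\<close>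
  define d2 where "d2 = (if F s d1 d0 + F s d0 d1 \<le> 0 then d0 else - d0)"
  have d2: "d2 \<in> S" "0 \<le> N d2 d2" "F s d2 d2 < 0" and cross: "F s d1 d2 + F s d2 d1 \<le> 0"
    using d0 subspace_neg[OF S] unfolding d2_def F_def by (auto simp: bil)
  \<comment> \<open>Since \<open>(1 - s) * P d1 d1\<close> is nonnegative, the \<open>N\<close> term
    makes \<open>F s d1 d1\<close> negative. With the mirrored argument for \<open>d2\<close>, the
    difference \<open>N - P\<close> has opposite signs at the two ends of the segment.\<close>
  have "0 \<le> s * N d1 d1 \<Longrightarrow> False"
    using d1(2,3) s(2) unfolding F_def by (smt (verit) mult_nonneg_nonneg)
  then have N1: "N d1 d1 < 0"
    using s(1) by (meson mult_nonneg_nonneg not_le)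
  have "0 \<le> (1 - s) * P d2 d2 \<Longrightarrow> False"
    using d2(2,3) s(1) unfolding F_def by (smt (verit) mult_nonneg_nonneg)
  then have P2: "P d2 d2 < 0"
    using s(2) by (meson diff_ge_0_iff_ge mult_nonneg_nonneg not_le)
  define e where "e t = (1 - t) *\<^sub>R d1 + t *\<^sub>R d2" for t
  have expand: "G (e t) (e t) = (1 - t)\<^sup>2 * G d1 d1 + t * (1 - t) * (G d1 d2 + G d2 d1) + t\<^sup>2 * G d2 d2"
    if "G = P \<or> G = N" for G t
    using that
    by (elim disjE; simp only: e_def bil; simp add: power2_eq_square algebra_simps)
  have "\<exists>t\<ge>0. t \<le> 1 \<and> (N (e t) (e t) - P (e t) (e t)) = 0"
  proof (rule IVT')
    show "N (e 0) (e 0) - P (e 0) (e 0) \<le> 0"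
      using d1 N1 by (simp add: e_def)
    show "0 \<le> N (e 1) (e 1) - P (e 1) (e 1)"
      using d2 P2 by (simp add: e_def)
    show "continuous_on {0..1} (\<lambda>t. N (e t) (e t) - P (e t) (e t))"
      by (simp add: expand, intro continuous_intros)
  qed auto
  then obtain t where t: "0 \<le> t" "t \<le> 1" "N (e t) (e t) = P (e t) (e t)"
    by auto
  have "F s (e t) (e t) = (1 - t)\<^sup>2 * F s d1 d1 + t * (1 - t) * (F s d1 d2 + F s d2 d1) + t\<^sup>2 * F s d2 d2"
    unfolding F_def by (simp add: expand algebra_simps)
  moreover have "t * (1 - t) * (F s d1 d2 + F s d2 d1) \<le> 0"
    using t cross by (simp add: mult_nonneg_nonpos)
  moreover have "(1 - t)\<^sup>2 * F s d1 d1 + t\<^sup>2 * F s d2 d2 < 0"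
  proof (cases "t = 0")
    case False
    then have "t\<^sup>2 * F s d2 d2 < 0"
      using d2 by (simp add: mult_pos_neg)
    moreover have "(1 - t)\<^sup>2 * F s d1 d1 \<le> 0"
      using d1 by (simp add: mult_nonneg_nonpos)
    ultimately show ?thesis by simp
  qed (use d1 in simp)
  ultimately have "F s (e t) (e t) < 0"
    by simp
  \<comment> \<open>At the crossing point \<open>F s\<close> averages two equal values.\<close>
  moreover have "F s (e t) (e t) = P (e t) (e t)"
    unfolding F_def by (simp add: t algebra_simps)
  moreover have "e t \<in> S"
    unfolding e_def using S d1(1) d2(1) by (simp add: subspace_add subspace_scale)
  ultimately show False
    using nonneg t(3) by force
qed

text \<open>Coefficients belong to indices, so \<open>a\<close> may repeat vectors; the induction
  adds each new multiple to the coefficient of one index carrying that vector.\<close>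

lemma span_image_imp_sum:
  assumes "finite I" "x \<in> span (a ` I)"
  shows "\<exists>u. x = (\<Sum>i\<in>I. u i *\<^sub>R a i)"
  using assms(2)
proof (induction rule: span_induct_alt)
  case base
  show ?case by (rule exI[of _ "\<lambda>_. 0"]) simp
next
  case (step c y z)
  then obtain u j where u: "z = (\<Sum>i\<in>I. u i *\<^sub>R a i)" and j: "j \<in> I" "y = a j"
    by auto
  have "(\<Sum>i\<in>I. (u(j := u j + c)) i *\<^sub>R a i)
      = (\<Sum>i\<in>I. u i *\<^sub>R a i + (if i = j then c *\<^sub>R a i else 0))"
    by (intro sum.cong) (auto simp: algebra_simps)
  then have "(\<Sum>i\<in>I. (u(j := u j + c)) i *\<^sub>R a i) = c *\<^sub>R y + z"
    using assms(1) u j by (simp add: sum.distrib)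
  then show ?case by metis
qed

text \<open>The indexed convex combinations form a convex set containing every \<open>a j\<close>,
  through coefficients that are 1 at \<open>j\<close> and 0 elsewhere; hence this set contains the
  hull.\<close>

lemma convex_hull_image_imp_sum:
  fixes a :: "'b \<Rightarrow> 'a::real_vector"
  assumes "finite I" "x \<in> convex hull (a ` I)"
  shows "\<exists>u. (\<forall>i\<in>I. 0 \<le> u i) \<and> sum u I = 1 \<and> x = (\<Sum>i\<in>I. u i *\<^sub>R a i)"
proof -
  let ?C = "{x. \<exists>u. (\<forall>i\<in>I. 0 \<le> u i) \<and> sum u I = 1 \<and> x = (\<Sum>i\<in>I. u i *\<^sub>R a i)}"
  have "a ` I \<subseteq> ?C"
  proof safe
    fix j assume "j \<in> I"
    then have "a j = (\<Sum>i\<in>I. (if i = j then 1 else 0) *\<^sub>R a i)"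
      and "(\<Sum>i\<in>I. if i = j then 1 else 0 :: real) = 1"
      using assms(1) by (simp_all add: if_distrib[of "\<lambda>c. c *\<^sub>R _"] cong: if_cong)
    then show "\<exists>u. (\<forall>i\<in>I. 0 \<le> u i) \<and> sum u I = 1 \<and> a j = (\<Sum>i\<in>I. u i *\<^sub>R a i)"
      by (intro exI[of _ "\<lambda>i. if i = j then 1 else 0"]) simp
  qed
  moreover have "convex ?C"
  proof (rule convexI, safe)
    fix u v :: real and w1 w2 :: "'b \<Rightarrow> real"
    assume *: "0 \<le> u" "0 \<le> v" "u + v = 1" "\<forall>i\<in>I. 0 \<le> w1 i" "sum w1 I = 1"
      "\<forall>i\<in>I. 0 \<le> w2 i" "sum w2 I = 1"
    show "\<exists>w. (\<forall>i\<in>I. 0 \<le> w i) \<and> sum w I = 1 \<and>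
        u *\<^sub>R (\<Sum>i\<in>I. w1 i *\<^sub>R a i) + v *\<^sub>R (\<Sum>i\<in>I. w2 i *\<^sub>R a i) = (\<Sum>i\<in>I. w i *\<^sub>R a i)"
      using * by (intro exI[of _ "\<lambda>i. u * w1 i + v * w2 i"])
        (simp add: sum.distrib scaleR_sum_right scaleR_add_left flip: sum_distrib_left)
  qed
  ultimately have "convex hull (a ` I) \<subseteq> ?C"
    by (rule hull_minimal)
  then show ?thesis
    using assms(2) by auto
qed

text \<open>A common point of the span of the \<open>a i\<close> and the convex hull of the
  \<open>b k\<close> is the certificate. Without one, a hyperplane would strictly separate the
  compact hull from the closed span, and its normal would solve the system. The normalization of
  \<open>v\<close> keeps the certificate nontrivial.\<close>

lemma motzkin_alternative:
  fixes a :: "'i \<Rightarrow> 'a::euclidean_space" and b :: "'k \<Rightarrow> 'a"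
  assumes "finite I" "finite K" "K \<noteq> {}"
    and no_sol: "\<nexists>y. (\<forall>i\<in>I. inner (a i) y = 0) \<and> (\<forall>k\<in>K. inner (b k) y < 0)"
  shows "\<exists>u v. (\<forall>k\<in>K. 0 \<le> v k) \<and> sum v K = 1 \<and>
    (\<Sum>i\<in>I. u i *\<^sub>R a i) + (\<Sum>k\<in>K. v k *\<^sub>R b k) = 0"
proof -
  have "span (a ` I) \<inter> convex hull (b ` K) \<noteq> {}"
  proof
    assume "span (a ` I) \<inter> convex hull (b ` K) = {}"
    then obtain y \<beta> where y: "\<forall>x\<in>convex hull (b ` K). inner y x < \<beta>"
      "\<forall>x\<in>span (a ` I). \<beta> < inner y x"
      using separating_hyperplane_compact_closed[of "convex hull (b ` K)" "span (a ` I)"] assms(2,3)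
      by (auto simp: Int_commute subspace_imp_convex closed_span finite_imp_compact_convex_hull)
    have "\<beta> < 0"
      using y(2)[rule_format, OF span_zero] by simp
    \<comment> \<open>A nonzero value could be rescaled to be exactly \<open>\<beta>\<close>,
      against the strict bound on the span.\<close>
    have "inner y x = 0" if x: "x \<in> span (a ` I)" for x
    proof (rule ccontr)
      assume "inner y x \<noteq> 0"
      then have "inner y ((\<beta> / inner y x) *\<^sub>R x) = \<beta>"
        by simp
      moreover have "(\<beta> / inner y x) *\<^sub>R x \<in> span (a ` I)"
        using x by (rule span_scale)
      ultimately show False
        using y(2) by force
    qed
    then have "\<forall>i\<in>I. inner (a i) y = 0"
      by (metis imageI inner_commute span_base)
    moreover have "\<forall>k\<in>K. inner (b k) y < 0"
      using y(1) \<open>\<beta> < 0\<close> by (metis hull_inc imageI inner_commute order_less_trans)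
    ultimately show False
      using no_sol by blast
  qed
  then obtain x where x: "x \<in> span (a ` I)" "x \<in> convex hull (b ` K)"
    by auto
  obtain u where u: "x = (\<Sum>i\<in>I. u i *\<^sub>R a i)"
    using span_image_imp_sum[OF assms(1) x(1)] by auto
  obtain v where v: "\<forall>k\<in>K. 0 \<le> v k" "sum v K = 1" "x = (\<Sum>k\<in>K. v k *\<^sub>R b k)"
    using convex_hull_image_imp_sum[OF assms(2) x(2)] by auto
  have "(\<Sum>i\<in>I. (- u i) *\<^sub>R a i) + (\<Sum>k\<in>K. v k *\<^sub>R b k) = 0"
    using u v(3) by (simp add: sum_negf)
  then show ?thesis
    using v by (intro exI[of _ "\<lambda>i. - u i"] exI[of _ v]) simp
qed

text \<open>By \<open>opt\<close> the linear system has no solution with negative objective. The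
  Motzkin certificate of its homogenization, divided by the coefficient of the objective, is
  \<open>w\<close>; the vectors \<open>e\<close> and \<open>d0\<close> express MFCQ and make that
  coefficient positive. In the application \<open>\<alpha> i\<close> and \<open>\<gamma>\<close> are
  half the second derivatives along a critical direction.\<close>

lemma second_order_multiplier:
  fixes a :: "nat \<Rightarrow> 'a::euclidean_space"
  assumes "m \<le> N"
    and dual: "\<And>i k. i < m \<Longrightarrow> k < m \<Longrightarrow> inner (a i) (e k) = (if i = k then 1 else 0)"
    and d0: "\<And>i. i < m \<Longrightarrow> inner (a i) d0 = 0" "\<And>i. i \<in> {m..<N} \<Longrightarrow> inner (a i) d0 < 0"
    and opt: "\<And>z. (\<And>i. i < m \<Longrightarrow> inner (a i) z + \<alpha> i = 0) \<Longrightarrow>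
      (\<And>i. i \<in> {m..<N} \<Longrightarrow> inner (a i) z + \<alpha> i < 0) \<Longrightarrow> 0 \<le> inner c z + \<gamma>"
  shows "\<exists>w. (\<forall>i\<in>{m..<N}. 0 \<le> w i) \<and> c + (\<Sum>i<N. w i *\<^sub>R a i) = 0 \<and>
    0 \<le> \<gamma> + (\<Sum>i<N. w i * \<alpha> i)"
proof -
  \<comment> \<open>Homogenization: the vector \<open>(0, -1)\<close> forces the extra coordinate of a solution to be positive.\<close>
  define a' where "a' i = (a i, \<alpha> i)" for i
  define b' where "b' i = (if i < N then (a i, \<alpha> i) else if i = N then (c, \<gamma>) else (0, -1))" for i
  have "\<nexists>y. (\<forall>i\<in>{..<m}. inner (a' i) y = 0) \<and> (\<forall>k\<in>{m..<Suc (Suc N)}. inner (b' k) y < 0)"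
  proof
    assume "\<exists>y. (\<forall>i\<in>{..<m}. inner (a' i) y = 0) \<and> (\<forall>k\<in>{m..<Suc (Suc N)}. inner (b' k) y < 0)"
    then obtain y where y: "\<forall>i<m. inner (a' i) y = 0" "\<forall>k\<in>{m..<Suc (Suc N)}. inner (b' k) y < 0"
      by auto
    obtain z \<tau> where "y = (z, \<tau>)"
      by fastforce
    with y have *: "\<And>i. i < m \<Longrightarrow> inner (a i) z + \<alpha> i * \<tau> = 0"
      "\<And>k. k \<in> {m..<Suc (Suc N)} \<Longrightarrow> inner (b' k) (z, \<tau>) < 0"
      by (simp_all add: a'_def)
    have "0 < \<tau>"
      using *(2)[of "Suc N"] \<open>m \<le> N\<close> by (simp add: b'_def)
    have "inner (a i) z + \<alpha> i * \<tau> < 0" if "i \<in> {m..<N}" for i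
      using *(2)[of i] that by (simp add: b'_def)
    \<comment> \<open>Division by \<open>\<tau>\<close> turns a homogenized solution into one of the
      original system.\<close>
    then have "0 \<le> inner c (z /\<^sub>R \<tau>) + \<gamma>"
      using *(1) \<open>0 < \<tau>\<close>
      by (intro opt) (auto simp: field_simps)
    moreover have "inner c z + \<gamma> * \<tau> < 0"
      using *(2)[of N] \<open>m \<le> N\<close> by (simp add: b'_def)
    ultimately show False
      using \<open>0 < \<tau>\<close> by (simp add: field_simps)
  qed
  from motzkin_alternative[OF _ _ _ this] \<open>m \<le> N\<close>
  obtain u v where v: "\<forall>k\<in>{m..<Suc (Suc N)}. 0 \<le> v k" "sum v {m..<Suc (Suc N)} = 1"
    and uv: "(\<Sum>i<m. u i *\<^sub>R a' i) + (\<Sum>k=m..<Suc (Suc N). v k *\<^sub>R b' k) = 0"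
    by auto
  have "(\<Sum>k=m..<N. v k *\<^sub>R b' k) = (\<Sum>k=m..<N. v k *\<^sub>R a' k)"
    by (intro sum.cong) (auto simp: a'_def b'_def)
  then have uv': "(\<Sum>i<m. u i *\<^sub>R a' i) + (\<Sum>k=m..<N. v k *\<^sub>R a' k) + v N *\<^sub>R (c, \<gamma>) + v (Suc N) *\<^sub>R (0, -1) = 0"
    using uv \<open>m \<le> N\<close> by (simp add: b'_def add.assoc)
  have grad: "(\<Sum>i<m. u i *\<^sub>R a i) + (\<Sum>k=m..<N. v k *\<^sub>R a k) + v N *\<^sub>R c = 0"
    using arg_cong[OF uv', of fst] by (simp add: a'_def fst_sum)
  have hess: "(\<Sum>i<m. u i * \<alpha> i) + (\<Sum>k=m..<N. v k * \<alpha> k) + v N * \<gamma> = v (Suc N)"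
    using arg_cong[OF uv', of snd] by (simp add: a'_def snd_sum)
  \<comment> \<open>Otherwise pairing the relation with \<open>d0\<close> annihilates the inequality
    coefficients, pairing with \<open>e k\<close> annihilates \<open>u k\<close>, and the second
    component annihilates \<open>v (Suc N)\<close>, although \<open>v\<close> sums to 1.\<close>
  have "v N \<noteq> 0"
  proof
    assume vN: "v N = 0"
    have "(\<Sum>k=m..<N. v k * - inner (a k) d0) = 0"
      using arg_cong[OF grad, of "\<lambda>y. inner y d0"] vN d0(1)
      by (simp add: inner_add_left inner_sum_left sum_negf)
    then have "\<forall>k\<in>{m..<N}. v k * - inner (a k) d0 = 0"
      using v(1) d0(2) by (subst (asm) sum_nonneg_eq_0_iff) (auto simp: mult_nonneg_nonpos less_imp_le)
    then have v0: "v k = 0" if "k \<in> {m..<N}" for k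
      using that d0(2)[of k] by auto
    have "u k = 0" if "k < m" for k
    proof -
      have "(\<Sum>i<m. u i * inner (a i) (e k)) = 0"
        using arg_cong[OF grad, of "\<lambda>y. inner y (e k)"] vN v0
        by (simp add: inner_add_left inner_sum_left)
      then show ?thesis
        using that by (simp add: dual if_distrib[of "(*) _"] cong: if_cong)
    qed
    then have "v (Suc N) = 0"
      using hess vN v0 by simp
    then show False
      using v(2) v0 vN \<open>m \<le> N\<close> by simp
  qed
  then have "0 < v N"
    using v(1) \<open>m \<le> N\<close> by (simp add: order_less_le)
  define w where "w i = (if i < m then u i else v i) / v N" for i
  have split: "{..<N} = {..<m} \<union> {m..<N}" "{..<m} \<inter> {m..<N} = {}"
    using \<open>m \<le> N\<close> by auto
  have sum_w: "(\<Sum>i<N. g i (w i)) = (\<Sum>i<m. g i (u i / v N)) + (\<Sum>i=m..<N. g i (v i / v N))"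
    for g :: "nat \<Rightarrow> real \<Rightarrow> 'b::comm_monoid_add"
    unfolding split(1) by (subst sum.union_disjoint) (auto simp: w_def intro!: arg_cong2[of _ _ _ _ "(+)"] sum.cong)
  have "v N *\<^sub>R (c + (\<Sum>i<N. w i *\<^sub>R a i)) = 0"
    using grad \<open>0 < v N\<close>
    by (simp add: sum_w[of "\<lambda>i x. x *\<^sub>R a i"] scaleR_add_right scaleR_sum_right add_ac)
  \<comment> \<open>The coefficient of \<open>(0, -1)\<close> is the slack in the second-order
    inequality.\<close>
  moreover have "v N * (\<gamma> + (\<Sum>i<N. w i * \<alpha> i)) = v (Suc N)"
    using hess \<open>0 < v N\<close>
    by (simp add: sum_w[of "\<lambda>i x. x * \<alpha> i"] distrib_left sum_distrib_left add_ac)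
  then have "0 \<le> \<gamma> + (\<Sum>i<N. w i * \<alpha> i)"
    using v(1) \<open>0 < v N\<close> \<open>m \<le> N\<close> by (metis atLeastLessThan_iff le_SucI lessI mult_le_cancel_left_pos mult_zero_right)
  moreover have "\<forall>i\<in>{m..<N}. 0 \<le> w i"
    using v(1) \<open>0 < v N\<close> by (auto simp: w_def)
  ultimately show ?thesis
    using \<open>0 < v N\<close> by auto
qed

section \<open>Second-order necessary conditions under MFCQ\<close>

text \<open>The hypothesis on \<open>v\<close> says that \<open>v t\<close> equals
  \<open>t *\<^sub>R d + t\<^sup>2 *\<^sub>R z\<close> up to a term of order o(t^2). The limit is
  then the second-order Taylor expansion of \<open>F\<close> at \<open>x\<close>, whose remainder
  \<open>T\<close> is controlled by the mean value inequality from differentiability of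
  \<open>G\<close> at \<open>x\<close>.\<close>

lemma second_order_along_curve:
  fixes F :: "'a::euclidean_space \<Rightarrow> real"
  assumes G: "\<And>y. GDERIV F y :> G y" and H: "(G has_derivative H) (at x)"
    and v: "((\<lambda>t. (v t - t *\<^sub>R d) /\<^sub>R t\<^sup>2) \<longlongrightarrow> z) (at_right 0)"
  shows "((\<lambda>t. (F (x + v t) - F x - t * inner (G x) d) / t\<^sup>2)
           \<longlongrightarrow> inner (G x) z + inner d (H d) / 2) (at_right 0)"
proof -
  interpret H: bounded_linear H
    using H by (rule has_derivative_bounded_linear)
  define T where "T w = F (x + w) - F x - inner (G x) w - inner w (H w) / 2" for w
  have T_bound: "\<exists>\<delta>>0. \<forall>w. norm w < \<delta> \<longrightarrow> norm (T w) \<le> e * (norm w)\<^sup>2" if "e > 0" for e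
  proof -
    obtain \<delta> where \<delta>: "\<delta> > 0"
      "\<And>y. norm (y - x) < \<delta> \<Longrightarrow> norm (G y - G x - H (y - x)) \<le> e * norm (y - x)"
      using H \<open>e > 0\<close> unfolding has_derivative_at_alt by blast
    have "norm (T w) \<le> e * (norm w)\<^sup>2" if w: "norm w < \<delta>" for w
    proof -
      \<comment> \<open>\<open>T w\<close> is the increment of \<open>\<psi>\<close> from 0 to 1,
        and its derivative \<open>D\<close> is \<open>w\<close> paired with the first-order error of
        \<open>G\<close> at \<open>x\<close>.\<close>
      define \<psi> where "\<psi> s = F (x + s *\<^sub>R w) - s * inner (G x) w - s\<^sup>2 * (inner w (H w) / 2)" for s
      define D where "D s = inner w (G (x + s *\<^sub>R w) - G x - H (s *\<^sub>R w))" for s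
      have deriv: "(\<psi> has_real_derivative D s) (at s within {0..1})" for s
      proof -
        have "((\<lambda>s. x + s *\<^sub>R w) has_derivative (\<lambda>s. s *\<^sub>R w)) (at s within {0..1})"
          by (auto intro!: derivative_eq_intros)
        then have "((\<lambda>s. F (x + s *\<^sub>R w)) has_derivative (\<lambda>r. inner (r *\<^sub>R w) (G (x + s *\<^sub>R w))))
            (at s within {0..1})"
          using G[of "x + s *\<^sub>R w", unfolded gderiv_def] by (rule has_derivative_compose)
        then have "((\<lambda>s. F (x + s *\<^sub>R w)) has_real_derivative inner w (G (x + s *\<^sub>R w)))
            (at s within {0..1})"
          by (simp add: has_real_derivative_iff_has_vector_derivative has_vector_derivative_def)
        then show ?thesis
          unfolding \<psi>_def D_def
          by (auto intro!: derivative_eq_intros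
              simp: inner_diff_right H.scaleR inner_commute power2_eq_square)
      qed
      have "norm (D s) \<le> e * (norm w)\<^sup>2" if s: "s \<in> {0..1}" for s
      proof -
        have sw: "norm (s *\<^sub>R w) \<le> norm w"
          using s by (simp add: mult_left_le_one_le)
        then have "norm (G (x + s *\<^sub>R w) - G x - H (s *\<^sub>R w)) \<le> e * norm (s *\<^sub>R w)"
          using \<delta>(2)[of "x + s *\<^sub>R w"] w by simp
        also have "\<dots> \<le> e * norm w"
          using sw \<open>e > 0\<close> by (intro mult_left_mono) auto
        finally have "norm w * norm (G (x + s *\<^sub>R w) - G x - H (s *\<^sub>R w)) \<le> norm w * (e * norm w)"
          by (intro mult_left_mono) auto
        then show ?thesis
          unfolding D_def using Cauchy_Schwarz_ineq2[of w "G (x + s *\<^sub>R w) - G x - H (s *\<^sub>R w)"]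
          by (simp add: power2_eq_square ac_simps)
      qed
      then have "norm (\<psi> 1 - \<psi> 0) \<le> e * (norm w)\<^sup>2 * norm (1 - 0 :: real)"
        by (intro field_differentiable_bound[of "{0..1}", OF _ deriv]) auto
      then show ?thesis
        by (simp add: \<psi>_def T_def)
    qed
    then show ?thesis
      using \<delta>(1) by blast
  qed
  have "T 0 = 0"
    by (simp add: T_def H.zero)
  \<comment> \<open>The point \<open>w = 0\<close>, where the quotient is 0 by the convention for
    division, is included because \<open>v t\<close> may vanish.\<close>
  have rest: "((\<lambda>w. T w / (norm w)\<^sup>2) \<longlongrightarrow> 0) (nhds 0)"
  proof (rule tendstoI)
    fix e :: real assume "e > 0"
    then obtain \<delta> where \<delta>: "\<delta> > 0" "\<forall>w. norm w < \<delta> \<longrightarrow> norm (T w) \<le> e / 2 * (norm w)\<^sup>2"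
      using T_bound[of "e / 2"] by auto
    have "dist (T w / (norm w)\<^sup>2) 0 < e" if "norm w < \<delta>" for w
    proof (cases "w = 0")
      case False
      then show ?thesis
        using \<delta>(2) that \<open>e > 0\<close> by (auto simp: abs_divide field_simps) (smt (verit) mult_pos_pos zero_less_norm_iff zero_less_power)
    qed (use \<open>e > 0\<close> in simp)
    then show "\<forall>\<^sub>F w in nhds 0. dist (T w / (norm w)\<^sup>2) 0 < e"
      unfolding eventually_nhds_metric using \<delta>(1) by auto
  qed
  have t0: "((\<lambda>t::real. t) \<longlongrightarrow> 0) (at_right 0)"
    by simp
  have pos: "\<forall>\<^sub>F t in at_right 0. 0 < (t::real)"
    by (rule eventually_at_right_less)
  have "((\<lambda>t. t *\<^sub>R ((v t - t *\<^sub>R d) /\<^sub>R t\<^sup>2) + d) \<longlongrightarrow> 0 *\<^sub>R z + d) (at_right 0)"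
    by (intro tendsto_intros v t0)
  moreover have "\<forall>\<^sub>F t in at_right 0. t *\<^sub>R ((v t - t *\<^sub>R d) /\<^sub>R t\<^sup>2) + d = v t /\<^sub>R t"
    using pos by eventually_elim
      (simp add: power2_eq_square scaleR_diff_right flip: mult.assoc)
  ultimately have vt: "((\<lambda>t. v t /\<^sub>R t) \<longlongrightarrow> d) (at_right 0)"
    by (simp add: tendsto_cong)
  have "((\<lambda>t. t *\<^sub>R (v t /\<^sub>R t)) \<longlongrightarrow> 0 *\<^sub>R d) (at_right 0)"
    by (intro tendsto_intros vt t0)
  moreover have "\<forall>\<^sub>F t in at_right 0. t *\<^sub>R (v t /\<^sub>R t) = v t"
    using pos by eventually_elim simp
  ultimately have v0: "(v \<longlongrightarrow> 0) (at_right 0)"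
    by (simp add: tendsto_cong)
  have "((\<lambda>t. inner (G x) ((v t - t *\<^sub>R d) /\<^sub>R t\<^sup>2) + inner (v t /\<^sub>R t) (H (v t /\<^sub>R t)) / 2
        + T (v t) / (norm (v t))\<^sup>2 * (norm (v t /\<^sub>R t))\<^sup>2)
      \<longlongrightarrow> inner (G x) z + inner d (H d) / 2 + 0 * (norm d)\<^sup>2) (at_right 0)"
    by (intro tendsto_intros v vt H.tendsto filterlim_compose[OF rest v0]) simp
  moreover have "\<forall>\<^sub>F t in at_right 0.
      inner (G x) ((v t - t *\<^sub>R d) /\<^sub>R t\<^sup>2) + inner (v t /\<^sub>R t) (H (v t /\<^sub>R t)) / 2
        + T (v t) / (norm (v t))\<^sup>2 * (norm (v t /\<^sub>R t))\<^sup>2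
      = (F (x + v t) - F x - t * inner (G x) d) / t\<^sup>2"
    using pos
  proof eventually_elim
    case (elim t)
    have "(norm (v t /\<^sub>R t))\<^sup>2 = (norm (v t))\<^sup>2 / t\<^sup>2"
      by (simp add: power_mult_distrib power_inverse divide_inverse)
    then have "T (v t) / (norm (v t))\<^sup>2 * (norm (v t /\<^sub>R t))\<^sup>2 = T (v t) / t\<^sup>2"
      using \<open>T 0 = 0\<close> by (cases "v t = 0") simp_all
    then show ?case
      using elim by (simp add: T_def H.scaleR inner_diff_right divide_simps power2_eq_square algebra_simps)
  qed
  ultimately show ?thesis
    by (simp add: tendsto_cong)
qed

text \<open>
  With \<open>e\<close> dual to the gradients at \<open>x0\<close>, the equation \<open>c = 0\<close> near \<open>y\<close> is solved by the fixed point
  of a simplified Newton iteration.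
\<close>

lemma metric_regularity:
  fixes c :: "nat \<Rightarrow> 'a::euclidean_space \<Rightarrow> real"
  assumes G: "\<And>i y. i < m \<Longrightarrow> GDERIV (c i) y :> G i y"
    and cont: "\<And>i. i < m \<Longrightarrow> isCont (G i) x0"
    and zero: "\<And>i. i < m \<Longrightarrow> c i x0 = 0"
    and dual: "\<And>i k. i < m \<Longrightarrow> k < m \<Longrightarrow> inner (G i x0) (e k) = (if i = k then 1 else 0)"
  shows "\<exists>\<rho>>0. \<forall>y\<in>ball x0 \<rho>. \<exists>x. (\<forall>i<m. c i x = 0) \<and>
    dist x y \<le> 2 * norm (\<Sum>i<m. c i y *\<^sub>R e i)"
proof -
  \<comment> \<open>The part of \<open>c\<close> beyond its linearization at \<open>x0\<close>,
    lifted by \<open>e\<close>. Its derivative vanishes at \<open>x0\<close>, so \<open>E\<close>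
    has Lipschitz constant 1/2 near \<open>x0\<close>.\<close>
  define E where "E x = (\<Sum>i<m. (c i x - inner (G i x0) x) *\<^sub>R e i)" for x
  define E' where "E' x v = (\<Sum>i<m. inner v (G i x - G i x0) *\<^sub>R e i)" for x v
  have E': "(E has_derivative E' x) (at x within X)" for x X
    unfolding E_def E'_def
    by (intro has_derivative_at_withinI[of _ _ _ X] has_derivative_sum has_derivative_scaleR_left)
      (auto intro!: derivative_eq_intros G[unfolded gderiv_def] simp: inner_diff_right inner_commute)
  have onorm: "onorm (E' x) \<le> (\<Sum>i<m. norm (G i x - G i x0) * norm (e i))" for x
  proof (rule onorm_le)
    fix v
    have "norm (E' x v) \<le> (\<Sum>i<m. norm (inner v (G i x - G i x0) *\<^sub>R e i))"
      unfolding E'_def by (rule norm_sum)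
    also have "\<dots> \<le> (\<Sum>i<m. norm v * norm (G i x - G i x0) * norm (e i))"
      by (intro sum_mono) (simp add: mult_right_mono Cauchy_Schwarz_ineq2)
    finally show "norm (E' x v) \<le> (\<Sum>i<m. norm (G i x - G i x0) * norm (e i)) * norm v"
      by (simp add: sum_distrib_left ac_simps)
  qed
  have "((\<lambda>x. \<Sum>i<m. norm (G i x - G i x0) * norm (e i)) \<longlongrightarrow> (\<Sum>i<m. norm (G i x0 - G i x0) * norm (e i)))
      (nhds x0)"
    using cont by (intro tendsto_intros) (auto simp: continuous_at tendsto_nhds_iff)
  then have "\<forall>\<^sub>F x in nhds x0. (\<Sum>i<m. norm (G i x - G i x0) * norm (e i)) < 1 / 2"
    by (rule order_tendstoD(2)) simp
  then obtain \<delta> where \<delta>: "\<delta> > 0"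
    "\<And>x. dist x x0 < \<delta> \<Longrightarrow> (\<Sum>i<m. norm (G i x - G i x0) * norm (e i)) < 1 / 2"
    unfolding eventually_nhds_metric by auto
  have "onorm (E' x) \<le> 1 / 2" if "x \<in> ball x0 \<delta>" for x
    using onorm[of x] \<delta>(2)[of x] that by (simp add: dist_commute)
  then have lip: "norm (E x - E y) \<le> 1 / 2 * norm (x - y)" if "x \<in> ball x0 \<delta>" "y \<in> ball x0 \<delta>" for x y
    using that by (intro differentiable_bound[OF convex_ball[of x0 \<delta>] E'])
  \<comment> \<open>Twice the length of the first iteration step from \<open>y\<close>, so that a
    map with contraction factor 1/2 sends \<open>cball y (R y)\<close> into itself.\<close>
  define R where "R y = 2 * norm (\<Sum>i<m. c i y *\<^sub>R e i)" for y
  have "isCont (c i) x0" if "i < m" for i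
    using G[OF that] unfolding gderiv_def by (rule has_derivative_continuous)
  then have "(R \<longlongrightarrow> 2 * norm (\<Sum>i<m. c i x0 *\<^sub>R e i)) (nhds x0)"
    unfolding R_def by (intro tendsto_intros) (auto simp: continuous_at tendsto_nhds_iff)
  then have "\<forall>\<^sub>F y in nhds x0. R y < \<delta> / 2"
    by (rule order_tendstoD(2)) (use zero \<delta>(1) in simp)
  then obtain \<rho> where \<rho>: "\<rho> > 0" "\<And>y. dist y x0 < \<rho> \<Longrightarrow> R y < \<delta> / 2"
    unfolding eventually_nhds_metric by auto
  show ?thesis
  proof (intro exI[of _ "min \<rho> (\<delta> / 2)"] conjI ballI)
    fix y assume "y \<in> ball x0 (min \<rho> (\<delta> / 2))"
    then have y: "dist y x0 < \<delta> / 2" "R y < \<delta> / 2"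
      using \<rho>(2) by (auto simp: dist_commute)
    \<comment> \<open>On \<open>y\<close> plus the span of the \<open>e i\<close> this is the
      simplified Newton step, which subtracts \<open>\<Sum>i<m. c i x *\<^sub>R e i\<close> from
      \<open>x\<close>.\<close>
    define N where "N x = y - E x - (\<Sum>i<m. inner (G i x0) y *\<^sub>R e i)" for x
    have sub: "x \<in> ball x0 \<delta>" if "x \<in> cball y (R y)" for x
      using that y dist_triangle[of x x0 y] by (simp add: dist_commute)
    have lipN: "dist (N x) (N z) \<le> 1 / 2 * dist x z" if "x \<in> cball y (R y)" "z \<in> cball y (R y)" for x z
      using lip[OF that[THEN sub]] unfolding N_def by (simp add: dist_norm norm_minus_commute)
    have Ny: "dist (N y) y = R y / 2"
    proof -
      have "N y = y - (\<Sum>i<m. c i y *\<^sub>R e i)"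
        by (simp add: N_def E_def scaleR_diff_left sum_subtractf)
      then show ?thesis
        by (simp add: R_def dist_norm)
    qed
    have "0 \<le> R y"
      by (simp add: R_def)
    have "N ` cball y (R y) \<subseteq> cball y (R y)"
    proof
      fix w assume "w \<in> N ` cball y (R y)"
      then obtain x where x: "x \<in> cball y (R y)" "w = N x" by auto
      have "dist y w \<le> dist (N x) (N y) + dist (N y) y"
        using x(2) dist_triangle[of "N x" y "N y"] by (simp add: dist_commute)
      also have "\<dots> \<le> 1 / 2 * dist x y + R y / 2"
        using lipN[OF x(1), of y] Ny \<open>0 \<le> R y\<close> by simp
      also have "\<dots> \<le> R y"
        using x(1) by (simp add: dist_commute)
      finally show "w \<in> cball y (R y)" by simp
    qed
    then obtain x where x: "x \<in> cball y (R y)" "N x = x"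
      using Banach_fix[of "cball y (R y)" "1 / 2" N] lipN \<open>0 \<le> R y\<close>
      by (auto simp: complete_eq_closed)
    \<comment> \<open>Pairing the fixed point equation with \<open>G k x0\<close> isolates
      \<open>c k x\<close> by duality.\<close>
    have "c k x = 0" if k: "k < m" for k
    proof -
      have "(\<Sum>i<m. r i * inner (G k x0) (e i)) = r k" for r
        using k by (simp add: dual if_distrib[of "(*) _"] cong: if_cong)
      then have "inner (G k x0) (N x) = inner (G k x0) y - (c k x - inner (G k x0) x) - inner (G k x0) y"
        unfolding N_def E_def by (simp add: inner_diff_right inner_sum_right)
      then show ?thesis
        using x(2) by simp
    qed
    then show "\<exists>x. (\<forall>i<m. c i x = 0) \<and> dist x y \<le> 2 * norm (\<Sum>i<m. c i y *\<^sub>R e i)"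
      using x(1) unfolding R_def by (auto simp: dist_commute)
  qed (use \<rho>(1) \<delta>(1) in simp)
qed

text \<open>Suppose some \<open>z\<close> solves the second-order system with negative objective.
  The parabola with velocity \<open>d\<close> and second-order coefficient \<open>z\<close> is then
  moved onto the equality constraints by metric regularity; for small positive \<open>t\<close> it
  is feasible and has smaller \<open>f\<close>, contradicting minimality. So the alternative
  applies, and the resulting \<open>w\<close> may depend on \<open>d\<close>.\<close>

lemma second_order_necessary:
  fixes f :: "'a::euclidean_space \<Rightarrow> real" and c :: "nat \<Rightarrow> 'a \<Rightarrow> real"
  assumes "m \<le> N"
    and Gf: "\<And>y. GDERIV f y :> Gf y" and Hf: "(Gf has_derivative Hf) (at x)"
    and Gc: "\<And>i y. i < N \<Longrightarrow> GDERIV (c i) y :> Gc i y"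
    and Hc: "\<And>i. i < N \<Longrightarrow> (Gc i has_derivative Hc i) (at x)"
    and zero: "\<And>i. i < N \<Longrightarrow> c i x = 0"
    and min: "\<forall>\<^sub>F y in nhds x. (\<forall>i<m. c i y = 0) \<longrightarrow> (\<forall>i\<in>{m..<N}. c i y \<le> 0) \<longrightarrow> f x \<le> f y"
    and dual: "\<And>i k. i < m \<Longrightarrow> k < m \<Longrightarrow> inner (Gc i x) (e k) = (if i = k then 1 else 0)"
    and d0: "\<And>i. i < m \<Longrightarrow> inner (Gc i x) d0 = 0" "\<And>i. i \<in> {m..<N} \<Longrightarrow> inner (Gc i x) d0 < 0"
    and d: "\<And>i. i < N \<Longrightarrow> inner (Gc i x) d = 0" "inner (Gf x) d = 0"
  shows "\<exists>w. (\<forall>i\<in>{m..<N}. 0 \<le> w i) \<and> Gf x + (\<Sum>i<N. w i *\<^sub>R Gc i x) = 0 \<and>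
    0 \<le> inner d (Hf d) + (\<Sum>i<N. w i * inner d (Hc i d))"
proof -
  have pos: "\<forall>\<^sub>F t in at_right 0. 0 < (t::real)"
    by (rule eventually_at_right_less)
  have opt: "0 \<le> inner (Gf x) z + inner d (Hf d) / 2"
    if z_eq: "\<And>i. i < m \<Longrightarrow> inner (Gc i x) z + inner d (Hc i d) / 2 = 0"
      and z_less: "\<And>i. i \<in> {m..<N} \<Longrightarrow> inner (Gc i x) z + inner d (Hc i d) / 2 < 0" for z
  proof (rule ccontr)
    assume "\<not> ?thesis"
    then have z_f: "inner (Gf x) z + inner d (Hf d) / 2 < 0"
      by simp
    define y where "y t = t *\<^sub>R d + t\<^sup>2 *\<^sub>R z" for t
    have "\<forall>\<^sub>F t in at_right 0. (y t - t *\<^sub>R d) /\<^sub>R t\<^sup>2 = z"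
      using pos by eventually_elim (simp add: y_def)
    then have y: "((\<lambda>t. (y t - t *\<^sub>R d) /\<^sub>R t\<^sup>2) \<longlongrightarrow> z) (at_right 0)"
      by (rule tendsto_eventually)
    \<comment> \<open>The choice of \<open>z\<close> cancels the second-order term of the equality
      constraints, so the correction onto them is of order o(t^2).\<close>
    have c_y: "((\<lambda>t. c i (x + y t) / t\<^sup>2) \<longlongrightarrow> 0) (at_right 0)" if "i < m" for i
      using second_order_along_curve[OF Gc Hc y, of i] that \<open>m \<le> N\<close> zero d(1) z_eq by simp
    have "isCont (Gc i) x" if "i < N" for i
      using Hc[OF that] by (rule has_derivative_continuous)
    then have "\<exists>\<rho>>0. \<forall>y\<in>ball x \<rho>. \<exists>u. (\<forall>i<m. c i u = 0) \<and> dist u y \<le> 2 * norm (\<Sum>i<m. c i y *\<^sub>R e i)"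
      using \<open>m \<le> N\<close> Gc zero dual
      by (intro metric_regularity[where G = Gc]) auto
    then obtain \<rho> X where \<rho>: "\<rho> > 0" and X: "\<And>y. y \<in> ball x \<rho> \<Longrightarrow> (\<forall>i<m. c i (X y) = 0)"
      "\<And>y. y \<in> ball x \<rho> \<Longrightarrow> dist (X y) y \<le> 2 * norm (\<Sum>i<m. c i y *\<^sub>R e i)"
      by metis
    have "(y \<longlongrightarrow> 0 *\<^sub>R d + 0\<^sup>2 *\<^sub>R z) (at_right 0)"
      unfolding y_def by (intro tendsto_intros)
    then have "\<forall>\<^sub>F t in at_right 0. dist (y t) 0 < \<rho>"
      using \<rho> by (intro tendstoD) simp_all
    then have in_ball: "\<forall>\<^sub>F t in at_right 0. x + y t \<in> ball x \<rho>"
      by eventually_elim (simp add: dist_norm)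
    \<comment> \<open>The corrected curve satisfies the equalities exactly and keeps the
      second-order coefficient \<open>z\<close>.\<close>
    define v where "v t = X (x + y t) - x" for t
    have "((\<lambda>t. (X (x + y t) - (x + y t)) /\<^sub>R t\<^sup>2) \<longlongrightarrow> 0) (at_right 0)"
    proof (rule Lim_null_comparison)
      show "\<forall>\<^sub>F t in at_right 0. norm ((X (x + y t) - (x + y t)) /\<^sub>R t\<^sup>2)
          \<le> 2 * norm (\<Sum>i<m. (c i (x + y t) / t\<^sup>2) *\<^sub>R e i)"
        using in_ball pos
      proof eventually_elim
        case (elim t)
        have "(\<Sum>i<m. (c i (x + y t) / t\<^sup>2) *\<^sub>R e i) = (\<Sum>i<m. c i (x + y t) *\<^sub>R e i) /\<^sub>R t\<^sup>2"
          by (simp add: scaleR_sum_right divide_inverse mult.commute)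
        moreover have "norm (X (x + y t) - (x + y t)) / t\<^sup>2 \<le> 2 * norm (\<Sum>i<m. c i (x + y t) *\<^sub>R e i) / t\<^sup>2"
          using X(2)[OF elim(1)] by (intro divide_right_mono) (simp_all add: dist_norm)
        ultimately show ?case
          by (simp add: divide_inverse ac_simps)
      qed
      have "((\<lambda>t. 2 * norm (\<Sum>i<m. (c i (x + y t) / t\<^sup>2) *\<^sub>R e i))
          \<longlongrightarrow> 2 * norm (\<Sum>i<m. 0 *\<^sub>R e i)) (at_right 0)"
        using c_y by (intro tendsto_intros) auto
      then show "((\<lambda>t. 2 * norm (\<Sum>i<m. (c i (x + y t) / t\<^sup>2) *\<^sub>R e i)) \<longlongrightarrow> 0) (at_right 0)"
        by simp
    qed
    then have "((\<lambda>t. (X (x + y t) - (x + y t)) /\<^sub>R t\<^sup>2 + (y t - t *\<^sub>R d) /\<^sub>R t\<^sup>2) \<longlongrightarrow> 0 + z) (at_right 0)"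
      using y by (rule tendsto_add)
    then have v: "((\<lambda>t. (v t - t *\<^sub>R d) /\<^sub>R t\<^sup>2) \<longlongrightarrow> z) (at_right 0)"
      by (simp add: v_def algebra_simps)
    have "((\<lambda>t. t *\<^sub>R d + t\<^sup>2 *\<^sub>R ((v t - t *\<^sub>R d) /\<^sub>R t\<^sup>2) + x) \<longlongrightarrow> 0 *\<^sub>R d + 0\<^sup>2 *\<^sub>R z + x) (at_right 0)"
      by (intro tendsto_intros v)
    moreover have "\<forall>\<^sub>F t in at_right 0. t *\<^sub>R d + t\<^sup>2 *\<^sub>R ((v t - t *\<^sub>R d) /\<^sub>R t\<^sup>2) + x = x + v t"
      using pos by eventually_elim simp
    ultimately have "((\<lambda>t. x + v t) \<longlongrightarrow> 0 *\<^sub>R d + 0\<^sup>2 *\<^sub>R z + x) (at_right 0)"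
      by (rule Lim_transform_eventually)
    then have "((\<lambda>t. x + v t) \<longlongrightarrow> x) (at_right 0)"
      by simp
    then have "\<forall>\<^sub>F t in at_right 0. (\<forall>i<m. c i (x + v t) = 0) \<longrightarrow>
        (\<forall>i\<in>{m..<N}. c i (x + v t) \<le> 0) \<longrightarrow> f x \<le> f (x + v t)"
      using min by (rule eventually_compose_filterlim[rotated])
    moreover have "\<forall>\<^sub>F t in at_right 0. \<forall>i<m. c i (x + v t) = 0"
      using in_ball by eventually_elim (use X(1) in \<open>auto simp: v_def\<close>)
    moreover have "\<forall>\<^sub>F t in at_right 0. \<forall>i\<in>{m..<N}. c i (x + v t) \<le> 0"
    proof (rule eventually_ball_finite, safe)
      fix i assume i: "i \<in> {m..<N}"
      have "((\<lambda>t. c i (x + v t) / t\<^sup>2) \<longlongrightarrow> inner (Gc i x) z + inner d (Hc i d) / 2) (at_right 0)"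
        using second_order_along_curve[OF Gc Hc v, of i] i zero d(1) by simp
      then have "\<forall>\<^sub>F t in at_right 0. c i (x + v t) / t\<^sup>2 < 0"
        using z_less[OF i] by (rule order_tendstoD(2))
      with pos show "\<forall>\<^sub>F t in at_right 0. c i (x + v t) \<le> 0"
        by eventually_elim (simp add: divide_less_0_iff)
    qed
    moreover have "\<forall>\<^sub>F t in at_right 0. (f (x + v t) - f x) / t\<^sup>2 < 0"
      using second_order_along_curve[OF Gf Hf v] z_f d(2) by (intro order_tendstoD(2)) simp_all
    ultimately have "\<forall>\<^sub>F t in at_right (0::real). False"
      using pos by eventually_elim (auto simp: divide_less_0_iff)
    then show False
      by simp
  qed
  have "\<exists>w. (\<forall>i\<in>{m..<N}. 0 \<le> w i) \<and> Gf x + (\<Sum>i<N. w i *\<^sub>R Gc i x) = 0 \<and>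
      0 \<le> inner d (Hf d) / 2 + (\<Sum>i<N. w i * (inner d (Hc i d) / 2))"
    using \<open>m \<le> N\<close> dual d0 opt by (rule second_order_multiplier)
  then obtain w where "\<forall>i\<in>{m..<N}. 0 \<le> w i" "Gf x + (\<Sum>i<N. w i *\<^sub>R Gc i x) = 0"
    "0 \<le> inner d (Hf d) / 2 + (\<Sum>i<N. w i * (inner d (Hc i d) / 2))"
    by (elim exE conjE)
  then show ?thesis
    by (intro exI[of _ w]) (simp flip: sum_divide_distrib)
qed

text \<open>Pairing stationarity with \<open>d0\<close> bounds the nonnegative multipliers, because
  each summand is at most the total \<open>inner c d0\<close>; pairing with \<open>e i\<close> then
  bounds the others. Requiring \<open>w i = 0\<close> for \<open>i \<ge> N\<close> puts the set into
  a product of compact intervals in the function space.\<close>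

lemma compact_multipliers:
  fixes a :: "nat \<Rightarrow> 'a::euclidean_space"
  assumes "m \<le> N"
    and dual: "\<And>i k. i < m \<Longrightarrow> k < m \<Longrightarrow> inner (a i) (e k) = (if i = k then 1 else 0)"
    and d0: "\<And>i. i < m \<Longrightarrow> inner (a i) d0 = 0" "\<And>i. i \<in> {m..<N} \<Longrightarrow> inner (a i) d0 < 0"
  shows "compact {w. (\<forall>i\<ge>N. w i = 0) \<and> (\<forall>i\<in>{m..<N}. 0 \<le> w i) \<and>
    c + (\<Sum>i<N. w i *\<^sub>R a i) = 0}" (is "compact ?K")
proof -
  define B1 where "B1 i = \<bar>inner c d0\<bar> / - inner (a i) d0" for i
  define B where "B i = (if i < m then \<bar>inner c (e i)\<bar> + (\<Sum>j=m..<N. B1 j * \<bar>inner (a j) (e i)\<bar>)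
    else if i < N then B1 i else 0)" for i
  have split: "{..<N} = {..<m} \<union> {m..<N}" "{..<m} \<inter> {m..<N} = {}"
    using \<open>m \<le> N\<close> by auto
  have "w \<in> PiE UNIV (\<lambda>i. {- B i..B i})" if w: "w \<in> ?K" for w
  proof -
    have test: "inner c v + (\<Sum>i<m. w i * inner (a i) v) + (\<Sum>i=m..<N. w i * inner (a i) v) = 0" for v
      using arg_cong[of _ 0 "\<lambda>y. inner y v", OF conjunct2[OF conjunct2[OF w[unfolded mem_Collect_eq]]]] split
      by (simp add: inner_add_left inner_sum_left sum.union_disjoint)
    have b1: "\<bar>w j\<bar> \<le> B1 j" if j: "j \<in> {m..<N}" for j
    proof -
      have "w j * - inner (a j) d0 \<le> (\<Sum>i=m..<N. w i * - inner (a i) d0)"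
        using j w d0(2) by (intro member_le_sum) (auto simp: mult_nonneg_nonpos less_imp_le)
      also have "\<dots> = inner c d0"
        using test[of d0] d0(1) by (simp add: sum_negf)
      finally have "w j * - inner (a j) d0 \<le> \<bar>inner c d0\<bar>" by simp
      then show ?thesis
        using d0(2)[OF j] w j unfolding B1_def by (simp add: field_simps)
    qed
    have "\<bar>w i\<bar> \<le> B i" for i
    proof (cases "i < m")
      case True
      have "w i = - inner c (e i) - (\<Sum>j=m..<N. w j * inner (a j) (e i))"
        using test[of "e i"] True by (simp add: dual if_distrib[of "(*) _"] cong: if_cong)
      also have "\<bar>\<dots>\<bar> \<le> \<bar>inner c (e i)\<bar> + \<bar>\<Sum>j=m..<N. w j * inner (a j) (e i)\<bar>"
        by simp
      also have "\<bar>\<Sum>j=m..<N. w j * inner (a j) (e i)\<bar> \<le> (\<Sum>j=m..<N. B1 j * \<bar>inner (a j) (e i)\<bar>)"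
        using b1 by (intro order_trans[OF sum_abs] sum_mono) (simp add: abs_mult mult_right_mono)
      finally show ?thesis
        using True by (simp add: B_def)
    next
      case False
      then show ?thesis
        using b1[of i] w by (auto simp: B_def)
    qed
    then show ?thesis
      by (auto simp: abs_le_iff minus_le_iff)
  qed
  then have eq: "?K = PiE UNIV (\<lambda>i. {- B i..B i}) \<inter> ?K"
    by blast
  have "compact (PiE UNIV (\<lambda>i. {- B i..B i}))"
    using compactin_PiE[of "\<lambda>_. euclidean" UNIV "\<lambda>i. {- B i..B i}"]
    by (simp add: euclidean_product_topology)
  moreover have "closed ?K"
    unfolding Ball_def
    by (intro closed_Collect_conj closed_Collect_all closed_Collect_imp open_Collect_const
        closed_Collect_le closed_Collect_eq continuous_on_const continuous_on_add continuous_on_sum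
        continuous_on_scaleR continuous_on_product_coordinates)
  ultimately have "compact (PiE UNIV (\<lambda>i. {- B i..B i}) \<inter> ?K)"
    by (rule compact_Int_closed)
  then show ?thesis
    by (subst eq)
qed

section \<open>Derivative of a smooth singular value decomposition\<close>

text \<open>Each index contributes a matrix of product form, of rank at most 1, and rank is
  subadditive. This will count the nonzero singular values.\<close>

lemma mat_rank_le_card:
  fixes f g :: "'l \<Rightarrow> nat \<Rightarrow> real"
  assumes "finite L" "M \<in> carrier_mat nr nc"
    and "\<And>i k. i < nr \<Longrightarrow> k < nc \<Longrightarrow> M $$ (i, k) = (\<Sum>l\<in>L. f l i * g l k)"
  shows "mat_rank M \<le> card L"
  using assms
proof (induction L arbitrary: M rule: finite_induct)
  case empty
  then have "M = 0\<^sub>m nr nc"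
    by (intro eq_matI) auto
  then show ?case
    by (simp add: mat_rank_def vec_space.rank_0I)
next
  case (insert l L)
  define A where "A = Matrix.mat nr nc (\<lambda>(i, k). f l i * g l k)"
  define B where "B = Matrix.mat nr nc (\<lambda>(i, k). \<Sum>l\<in>L. f l i * g l k)"
  have carrier: "A \<in> carrier_mat nr nc" "B \<in> carrier_mat nr nc"
    by (simp_all add: A_def B_def)
  have "M = A + B"
    using insert by (intro eq_matI) (auto simp: A_def B_def)
  then have "mat_rank M \<le> mat_rank A + mat_rank B"
    using vec_space.rank_subadditive[OF carrier] carrier by (auto simp: mat_rank_def)
  moreover have "mat_rank A \<le> 1"
    using vec_space.rank_le_1_product_entries[OF carrier(1), of "f l" "g l"] carrier
    by (auto simp: mat_rank_def A_def)
  moreover have "mat_rank B \<le> card L"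
    using carrier by (intro insert.IH) (auto simp: B_def)
  ultimately show ?case
    using insert.hyps by simp
qed

text \<open>The scalar product of the vanishing combination with column \<open>l\<close> leaves
  \<open>c l\<close> times the squared length of that column.\<close>

lemma nonzero_orthogonal_cols_independent:
  assumes M: "nonzero_orthogonal_cols M" "M \<in> carrier_mat nr nc"
    and comb: "\<And>i. i < nr \<Longrightarrow> (\<Sum>l<k. c l * M $$ (i, l)) = 0"
    and l: "l < k" "k \<le> nc"
  shows "c l = 0"
proof -
  have col: "scalar_prod (col M l) (col M j) = (\<Sum>i<nr. M $$ (i, l) * M $$ (i, j))" if "j < k" for j
    using that M(2) l by (auto simp: scalar_prod_def atLeast0LessThan intro!: sum.cong)
  have orth: "scalar_prod (col M l) (col M j) = 0" if "j < k" "j \<noteq> l" for j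
    using that M l unfolding nonzero_orthogonal_cols_def by auto
  have "0 = (\<Sum>i<nr. M $$ (i, l) * (\<Sum>j<k. c j * M $$ (i, j)))"
    by (simp add: comb)
  also have "\<dots> = (\<Sum>j<k. c j * (\<Sum>i<nr. M $$ (i, l) * M $$ (i, j)))"
    unfolding sum_distrib_left by (subst sum.swap) (simp add: ac_simps)
  also have "\<dots> = (\<Sum>j<k. if j = l then c l * (\<Sum>i<nr. M $$ (i, l) * M $$ (i, l)) else 0)"
    by (intro sum.cong) (use orth col in auto)
  also have "\<dots> = c l * (\<Sum>i<nr. (M $$ (i, l))\<^sup>2)"
    using l by (simp add: power2_eq_square)
  finally have prod: "c l * (\<Sum>i<nr. (M $$ (i, l))\<^sup>2) = 0"
    by simp
  have "(\<Sum>i<nr. (M $$ (i, l))\<^sup>2) \<noteq> 0"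
  proof
    assume "(\<Sum>i<nr. (M $$ (i, l))\<^sup>2) = 0"
    then have "\<forall>i<nr. M $$ (i, l) = 0"
      by (simp add: sum_nonneg_eq_0_iff)
    then have "col M l = 0\<^sub>v (dim_row M)"
      using M(2) l by (intro eq_vecI) auto
    then show False
      using M l unfolding nonzero_orthogonal_cols_def by auto
  qed
  with prod show ?thesis by simp
qed

text \<open>A product with a rectangular diagonal matrix in the middle is a sum of one product term
  per diagonal entry, the form used both for counting rank and for differentiating.\<close>

lemma diagonal_decomposition_entry:
  fixes U D V :: "'a::comm_semiring_0 Matrix.mat"
  assumes "U \<in> carrier_mat nr nr" "D \<in> carrier_mat nr nc" "V \<in> carrier_mat nc nc"
    and diag: "diagonal_mat D" and ik: "i < nr" "k < nc"
  shows "(U * D * transpose_mat V) $$ (i, k)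
    = (\<Sum>l<min nr nc. U $$ (i, l) * D $$ (l, l) * V $$ (k, l))"
proof -
  have UD: "(U * D) $$ (i, l) = (if l < nr then U $$ (i, l) * D $$ (l, l) else 0)" if "l < nc" for l
  proof -
    have "(U * D) $$ (i, l) = (\<Sum>j<nr. U $$ (i, j) * D $$ (j, l))"
      using assms that by (auto simp: scalar_prod_def atLeast0LessThan intro!: sum.cong)
    also have "\<dots> = (\<Sum>j<nr. if j = l then U $$ (i, l) * D $$ (l, l) else 0)"
      using assms that by (intro sum.cong) (auto simp: diagonal_mat_def)
    finally show ?thesis by simp
  qed
  have "(W * transpose_mat V) $$ (i, k) = (\<Sum>l<nc. W $$ (i, l) * V $$ (k, l))"
    if "W \<in> carrier_mat nr nc" for W
    using assms that by (auto simp: scalar_prod_def atLeast0LessThan intro!: sum.cong)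
  from this[of "U * D"]
  have "(U * D * transpose_mat V) $$ (i, k) = (\<Sum>l<nc. (U * D) $$ (i, l) * V $$ (k, l))"
    using assms by simp
  also have "\<dots> = (\<Sum>l<nc. if l < nr then U $$ (i, l) * D $$ (l, l) * V $$ (k, l) else 0)"
    by (intro sum.cong) (auto simp: UD)
  also have "\<dots> = (\<Sum>l<min nr nc. U $$ (i, l) * D $$ (l, l) * V $$ (k, l))"
    by (simp add: sum.inter_filter[symmetric]) (intro sum.cong, auto)
  finally show ?thesis .
qed

text \<open>
  In direction \<open>v\<close> only the derivative of the first singular value vanishing at \<open>x\<close> survives: the
  earlier terms have both outer factors zero, the later singular values vanish identically near \<open>x\<close>.
\<close>

lemma smooth_svd_derivative_rank_one:
  fixes J :: "real ^ 'n \<Rightarrow> real Matrix.mat"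
  assumes svd: "smooth_svd nr nc J x"
    and rank_le: "\<forall>\<^sub>F y in nhds x. mat_rank (J y) \<le> mat_rank (J x) + 1"
  shows "\<exists>u \<rho>. \<forall>w b J' v.
    (\<forall>k<nc. (\<Sum>i<nr. w i * J x $$ (i, k)) = 0) \<longrightarrow>
    (\<forall>i<nr. (\<Sum>k<nc. J x $$ (i, k) * b k) = 0) \<longrightarrow>
    (\<forall>i<nr. \<forall>k<nc. ((\<lambda>y. J y $$ (i, k)) has_derivative J' i k) (at x)) \<longrightarrow>
    (\<Sum>i<nr. \<Sum>k<nc. w i * J' i k v * b k) = (\<Sum>i<nr. w i * u i) * \<rho> v b"
proof -
  define r where "r = mat_rank (J x)"
  define q where "q = min nr nc"
  obtain U S V where
    U: "\<And>y. U y \<in> carrier_mat nr nr"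
       "\<forall>\<^sub>F y in nhds x. \<forall>i<nr. \<forall>k<nr. (\<lambda>z. U z $$ (i, k)) differentiable (at y)" and
    S: "\<And>y. S y \<in> carrier_mat nr nc"
       "\<forall>\<^sub>F y in nhds x. \<forall>i<nr. \<forall>k<nc. (\<lambda>z. S z $$ (i, k)) differentiable (at y)" and
    V: "\<And>y. V y \<in> carrier_mat nc nc"
       "\<forall>\<^sub>F y in nhds x. \<forall>i<nc. \<forall>k<nc. (\<lambda>z. V z $$ (i, k)) differentiable (at y)" and
    J: "\<forall>\<^sub>F y in nhds x. J y = U y * S y * transpose_mat (V y) \<and> diagonal_mat (S y) \<and>
           (\<forall>l < q. mat_rank (J y) \<le> l \<longrightarrow> S y $$ (l, l) = 0)" and
    orth: "nonzero_orthogonal_cols (U x)" "nonzero_orthogonal_cols (V x)"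
    using svd unfolding smooth_svd_def differentiable_near_def q_def by blast
  define \<sigma> where "\<sigma> l y = S y $$ (l, l)" for l y
  obtain U' where U': "\<And>i k. i < nr \<Longrightarrow> k < nr \<Longrightarrow> ((\<lambda>z. U z $$ (i, k)) has_derivative U' i k) (at x)"
    using eventually_nhds_x_imp_x[OF U(2)] unfolding differentiable_def by metis
  obtain V' where V': "\<And>i k. i < nc \<Longrightarrow> k < nc \<Longrightarrow> ((\<lambda>z. V z $$ (i, k)) has_derivative V' i k) (at x)"
    using eventually_nhds_x_imp_x[OF V(2)] unfolding differentiable_def by metis
  have "\<sigma> l differentiable (at x)" if "l < q" for l
    using eventually_nhds_x_imp_x[OF S(2)] that unfolding \<sigma>_def q_def by simp
  then obtain \<sigma>' where \<sigma>': "\<And>l. l < q \<Longrightarrow> (\<sigma> l has_derivative \<sigma>' l) (at x)"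
    unfolding differentiable_def by metis
  have entry: "\<forall>\<^sub>F y in nhds x. \<forall>i<nr. \<forall>k<nc.
      J y $$ (i, k) = (\<Sum>l<q. U y $$ (i, l) * \<sigma> l y * V y $$ (k, l))"
    using J by eventually_elim
      (simp add: diagonal_decomposition_entry[OF U(1) S(1) V(1)] q_def \<sigma>_def)
  note entry_x = eventually_nhds_x_imp_x[OF entry]
  \<comment> \<open>Near \<open>x\<close> the rank is at most \<open>r + 1\<close>, so with 0-based
    indices only the entries \<open>0, ..., r\<close> can be nonzero.\<close>
  have \<sigma>_zero: "\<forall>\<^sub>F y in nhds x. \<forall>l<q. r < l \<longrightarrow> \<sigma> l y = 0"
    using J rank_le by eventually_elim (auto simp: \<sigma>_def r_def)
  have \<sigma>_zero_x: "\<sigma> l x = 0" if "l < q" "r \<le> l" for l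
    using eventually_nhds_x_imp_x[OF J] that by (auto simp: \<sigma>_def r_def)
  \<comment> \<open>If one of the first \<open>r\<close> entries vanished, \<open>J x\<close> would
    be a sum of fewer than \<open>r\<close> product terms.\<close>
  have \<sigma>_nonzero: "\<sigma> l x \<noteq> 0" if "l < q" "l < r" for l
  proof
    assume "\<sigma> l x = 0"
    have "J x $$ (i, k) = (\<Sum>j\<in>{..<q} \<inter> ({..<r} - {l}). (U x $$ (i, j) * \<sigma> j x) * V x $$ (k, j))"
      if "i < nr" "k < nc" for i k
    proof -
      have "J x $$ (i, k) = (\<Sum>j<q. U x $$ (i, j) * \<sigma> j x * V x $$ (k, j))"
        using entry_x that by simp
      also have "\<dots> = (\<Sum>j\<in>{..<q} \<inter> ({..<r} - {l}). U x $$ (i, j) * \<sigma> j x * V x $$ (k, j))"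
        using \<sigma>_zero_x \<open>\<sigma> l x = 0\<close> by (intro sum.mono_neutral_right) (auto, metis not_le)
      finally show ?thesis .
    qed
    moreover have "J x \<in> carrier_mat nr nc"
      using eventually_nhds_x_imp_x[OF J] mult_carrier_mat[OF mult_carrier_mat[OF U(1)[of x] S(1)[of x]]
        transpose_carrier_mat[THEN iffD2, OF V(1)[of x]]]
      by simp
    ultimately have "mat_rank (J x) \<le> card ({..<q} \<inter> ({..<r} - {l}))"
      by (intro mat_rank_le_card[where nr = nr and nc = nc and f = "\<lambda>j i. U x $$ (i, j) * \<sigma> j x"
            and g = "\<lambda>j k. V x $$ (k, j)"]) auto
    also have "\<dots> \<le> card ({..<r} - {l})"
      by (rule card_mono) auto
    also have "\<dots> < r"
      using that by (simp add: card_Diff_singleton)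
    finally show False
      by (simp add: r_def)
  qed
  \<comment> \<open>\<open>u\<close> is column \<open>r\<close> of \<open>U x\<close>, or 0 when
    there is no diagonal entry with index \<open>r\<close>. Neither \<open>u\<close> nor
    \<open>\<rho>\<close> depends on \<open>w\<close>, which makes the first factor linear in
    \<open>w\<close>.\<close>
  define u where "u i = (if r < q then U x $$ (i, r) else 0)" for i
  define \<rho> where "\<rho> v b = \<sigma>' r v * (\<Sum>k<nc. b k * V x $$ (k, r))" for v b
  show ?thesis
  proof (rule exI[of _ u], rule exI[of _ \<rho>], intro allI impI)
    fix w b J' v
    assume left: "\<forall>k<nc. (\<Sum>i<nr. w i * J x $$ (i, k)) = 0"
      and right: "\<forall>i<nr. (\<Sum>k<nc. J x $$ (i, k) * b k) = 0"
      and J': "\<forall>i<nr. \<forall>k<nc. ((\<lambda>y. J y $$ (i, k)) has_derivative J' i k) (at x)"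
    define \<alpha> where "\<alpha> l y = (\<Sum>i<nr. w i * U y $$ (i, l))" for l y
    define \<beta> where "\<beta> l y = (\<Sum>k<nc. b k * V y $$ (k, l))" for l y
    \<comment> \<open>These products are the coefficients of the vanishing row vector obtained from
      \<open>w\<close> and \<open>J x\<close>, expanded in the columns of
      \<open>V x\<close>.\<close>
    have "\<alpha> l x * \<sigma> l x = 0" if "l < q" for l
    proof (rule nonzero_orthogonal_cols_independent[OF orth(2) V(1) _ that])
      fix k assume "k < nc"
      have "(\<Sum>l<q. \<alpha> l x * \<sigma> l x * V x $$ (k, l)) = (\<Sum>i<nr. w i * J x $$ (i, k))"
        using entry_x \<open>k < nc\<close> unfolding \<alpha>_def
        by (simp add: sum_distrib_left sum_distrib_right) (subst sum.swap, simp add: ac_simps)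
      then show "(\<Sum>l<q. \<alpha> l x * \<sigma> l x * V x $$ (k, l)) = 0"
        using left \<open>k < nc\<close> by simp
    qed (simp add: q_def)
    then have \<alpha>0: "\<alpha> l x = 0" if "l < q" "l < r" for l
      using that \<sigma>_nonzero[OF that] by (metis mult_eq_0_iff)
    have "\<beta> l x * \<sigma> l x = 0" if "l < q" for l
    proof (rule nonzero_orthogonal_cols_independent[OF orth(1) U(1) _ that])
      fix i assume "i < nr"
      have "(\<Sum>l<q. \<beta> l x * \<sigma> l x * U x $$ (i, l)) = (\<Sum>k<nc. J x $$ (i, k) * b k)"
        using entry_x \<open>i < nr\<close> unfolding \<beta>_def
        by (simp add: sum_distrib_left sum_distrib_right) (subst sum.swap, simp add: ac_simps)
      then show "(\<Sum>l<q. \<beta> l x * \<sigma> l x * U x $$ (i, l)) = 0"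
        using right \<open>i < nr\<close> by simp
    qed (simp add: q_def)
    then have \<beta>0: "\<beta> l x = 0" if "l < q" "l < r" for l
      using that \<sigma>_nonzero[OF that] by (metis mult_eq_0_iff)
    define \<alpha>' where "\<alpha>' l v = (\<Sum>i<nr. w i * U' i l v)" for l v
    define \<beta>' where "\<beta>' l v = (\<Sum>k<nc. b k * V' k l v)" for l v
    have \<alpha>': "(\<alpha> l has_derivative \<alpha>' l) (at x)" if "l < q" for l
      unfolding \<alpha>_def \<alpha>'_def using that
      by (intro has_derivative_sum has_derivative_mult_right U') (auto simp: q_def)
    have \<beta>': "(\<beta> l has_derivative \<beta>' l) (at x)" if "l < q" for l
      unfolding \<beta>_def \<beta>'_def using that
      by (intro has_derivative_sum has_derivative_mult_right V') (auto simp: q_def)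
    define \<phi> where "\<phi> y = (\<Sum>i<nr. \<Sum>k<nc. w i * J y $$ (i, k) * b k)" for y
    have "(\<phi> has_derivative (\<lambda>v. \<Sum>i<nr. \<Sum>k<nc. w i * J' i k v * b k)) (at x)"
      unfolding \<phi>_def using J'
      by (intro has_derivative_sum has_derivative_mult_right has_derivative_mult_left) auto
    moreover have "(\<phi> has_derivative (\<lambda>v. \<Sum>l\<in>{l. l < q \<and> l \<le> r}.
        \<alpha> l x * \<sigma> l x * \<beta>' l v + (\<alpha> l x * \<sigma>' l v + \<alpha>' l v * \<sigma> l x) * \<beta> l x)) (at x)"
    proof (rule has_derivative_transform_eventually)
      show "((\<lambda>y. \<Sum>l\<in>{l. l < q \<and> l \<le> r}. \<alpha> l y * \<sigma> l y * \<beta> l y) has_derivative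
          (\<lambda>v. \<Sum>l\<in>{l. l < q \<and> l \<le> r}.
            \<alpha> l x * \<sigma> l x * \<beta>' l v + (\<alpha> l x * \<sigma>' l v + \<alpha>' l v * \<sigma> l x) * \<beta> l x)) (at x)"
        by (intro has_derivative_sum has_derivative_mult \<alpha>' \<beta>' \<sigma>') auto
      have ev: "\<forall>\<^sub>F y in nhds x. (\<Sum>l\<in>{l. l < q \<and> l \<le> r}. \<alpha> l y * \<sigma> l y * \<beta> l y) = \<phi> y"
        using entry \<sigma>_zero
      proof eventually_elim
        case (elim y)
        have "\<phi> y = (\<Sum>i<nr. \<Sum>k<nc. \<Sum>l<q. w i * (U y $$ (i, l) * \<sigma> l y * V y $$ (k, l)) * b k)"
          unfolding \<phi>_def using elim(1) by (simp add: sum_distrib_left sum_distrib_right)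
        also have "\<dots> = (\<Sum>i<nr. \<Sum>l<q. \<Sum>k<nc. w i * (U y $$ (i, l) * \<sigma> l y * V y $$ (k, l)) * b k)"
          by (subst (2) sum.swap) (rule refl)
        also have "\<dots> = (\<Sum>l<q. \<Sum>i<nr. \<Sum>k<nc. w i * (U y $$ (i, l) * \<sigma> l y * V y $$ (k, l)) * b k)"
          by (rule sum.swap)
        also have "\<dots> = (\<Sum>l<q. \<alpha> l y * \<sigma> l y * \<beta> l y)"
          unfolding \<alpha>_def \<beta>_def sum_distrib_right sum_distrib_left
          by (simp add: ac_simps) (rule sum.cong[OF refl], rule sum.swap)
        also have "\<dots> = (\<Sum>l\<in>{l. l < q \<and> l \<le> r}. \<alpha> l y * \<sigma> l y * \<beta> l y)"
          using elim(2) by (intro sum.mono_neutral_right) auto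
        finally show ?case by simp
      qed
      then show "\<forall>\<^sub>F y in at x. (\<Sum>l\<in>{l. l < q \<and> l \<le> r}. \<alpha> l y * \<sigma> l y * \<beta> l y) = \<phi> y"
        by (simp add: eventually_nhds_conv_at)
      show "(\<Sum>l\<in>{l. l < q \<and> l \<le> r}. \<alpha> l x * \<sigma> l x * \<beta> l x) = \<phi> x"
        using eventually_nhds_x_imp_x[OF ev] .
    qed simp
    ultimately have "(\<Sum>i<nr. \<Sum>k<nc. w i * J' i k v * b k) = (\<Sum>l\<in>{l. l < q \<and> l \<le> r}.
        \<alpha> l x * \<sigma> l x * \<beta>' l v + (\<alpha> l x * \<sigma>' l v + \<alpha>' l v * \<sigma> l x) * \<beta> l x)"
      by (rule has_derivative_unique[THEN fun_cong])
    \<comment> \<open>For \<open>l < r\<close> every product contains \<open>\<alpha> l x\<close> or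
      \<open>\<beta> l x\<close>, both 0; for \<open>l = r\<close> the factor
      \<open>\<sigma> r x\<close> is 0.\<close>
    also have "\<dots> = (\<Sum>l\<in>{l. l < q \<and> l \<le> r}. if l = r then \<alpha> r x * \<sigma>' r v * \<beta> r x else 0)"
      using \<alpha>0 \<beta>0 \<sigma>_zero_x by (intro sum.cong) auto
    also have "\<dots> = (\<Sum>i<nr. w i * u i) * \<rho> v b"
      by (auto simp: u_def \<rho>_def \<alpha>_def \<beta>_def sum.delta)
    finally show "(\<Sum>i<nr. \<Sum>k<nc. w i * J' i k v * b k) = (\<Sum>i<nr. w i * u i) * \<rho> v b" .
  qed
qed

section \<open>The weak second-order condition\<close>

text \<open>For fixed \<open>d\<close> in \<open>S\<close>, \<open>Q w d d\<close> changes with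
  \<open>\<tau> w\<close> at the constant rate \<open>\<rho> d\<close>. Hence whatever some
  multiplier achieves for \<open>d\<close> is also achieved by one of the two extremal for
  \<open>\<tau>\<close>, and \<open>yuan_lemma\<close> merges these two.\<close>

lemma weak_second_order_condition:
  fixes f :: "'a::euclidean_space \<Rightarrow> real" and c :: "nat \<Rightarrow> 'a \<Rightarrow> real"
  assumes "m \<le> N"
    and Gf: "\<And>y. GDERIV f y :> Gf y" and Hf: "(Gf has_derivative Hf) (at x)"
    and Gc: "\<And>i y. i < N \<Longrightarrow> GDERIV (c i) y :> Gc i y"
    and Hc: "\<And>i. i < N \<Longrightarrow> (Gc i has_derivative Hc i) (at x)"
    and zero: "\<And>i. i < N \<Longrightarrow> c i x = 0"
    and min: "\<forall>\<^sub>F y in nhds x. (\<forall>i<m. c i y = 0) \<longrightarrow> (\<forall>i\<in>{m..<N}. c i y \<le> 0) \<longrightarrow> f x \<le> f y"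
    and dual: "\<And>i k. i < m \<Longrightarrow> k < m \<Longrightarrow> inner (Gc i x) (e k) = (if i = k then 1 else 0)"
    and d0: "\<And>i. i < m \<Longrightarrow> inner (Gc i x) d0 = 0" "\<And>i. i \<in> {m..<N} \<Longrightarrow> inner (Gc i x) d0 < 0"
    and rank_one: "\<And>w d. (\<Sum>i<N. w i *\<^sub>R Gc i x) = 0 \<Longrightarrow> (\<And>i. i < N \<Longrightarrow> inner (Gc i x) d = 0) \<Longrightarrow>
      (\<Sum>i<N. w i * inner d (Hc i d)) = (\<Sum>i<N. w i * u i) * \<rho> d"
  shows "\<exists>w. (\<forall>i\<in>{m..<N}. 0 \<le> w i) \<and> Gf x + (\<Sum>i<N. w i *\<^sub>R Gc i x) = 0 \<and>
    (\<forall>d. (\<forall>i<N. inner (Gc i x) d = 0) \<longrightarrow>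
      0 \<le> inner d (Hf d) + (\<Sum>i<N. w i * inner d (Hc i d)))"
proof -
  define K where "K = {w. (\<forall>i\<ge>N. w i = 0) \<and> (\<forall>i\<in>{m..<N}. 0 \<le> w i) \<and>
    Gf x + (\<Sum>i<N. w i *\<^sub>R Gc i x) = 0}"
  define S where "S = {d. \<forall>i<N. inner (Gc i x) d = 0}"
  define Q where "Q w u v = inner u (Hf v) + (\<Sum>i<N. w i * inner u (Hc i v))" for w u v
  have ex_K: "\<exists>w\<in>K. 0 \<le> Q w d d" if d: "d \<in> S" "inner (Gf x) d = 0" for d
  proof -
    obtain w where w: "\<forall>i\<in>{m..<N}. 0 \<le> w i" "Gf x + (\<Sum>i<N. w i *\<^sub>R Gc i x) = 0"
      "0 \<le> inner d (Hf d) + (\<Sum>i<N. w i * inner d (Hc i d))"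
      using second_order_necessary[OF \<open>m \<le> N\<close> Gf Hf Gc Hc zero min dual d0, where d = d] d
      unfolding S_def by blast
    \<comment> \<open>Padding with zeros places the multiplier in \<open>K\<close> without changing
      the sums.\<close>
    define w' where "w' i = (if i < N then w i else 0)" for i
    have "w' \<in> K" "Q w' d d = inner d (Hf d) + (\<Sum>i<N. w i * inner d (Hc i d))"
      using w unfolding K_def Q_def w'_def by auto
    then show ?thesis
      using w(3) by (intro bexI[of _ w']) simp_all
  qed
  \<comment> \<open>The trivial direction shows that \<open>K\<close> is nonempty; stationarity of
    an element of \<open>K\<close> then makes \<open>Gf x\<close> orthogonal to \<open>S\<close>, as
    required by \<open>ex_K\<close>.\<close>
  have "0 \<in> S"
    by (simp add: S_def)
  then obtain w0 where w0: "w0 \<in> K"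
    using ex_K[of 0] by auto
  have Gf_S: "inner (Gf x) d = 0" if "d \<in> S" for d
  proof -
    have "inner (Gf x + (\<Sum>i<N. w0 i *\<^sub>R Gc i x)) d = 0"
      using w0 by (simp add: K_def)
    then show ?thesis
      using that by (simp add: S_def inner_add_left inner_sum_left)
  qed
  define \<tau> where "\<tau> w = (\<Sum>i<N. w i * u i)" for w
  have "compact K"
    unfolding K_def by (rule compact_multipliers[OF \<open>m \<le> N\<close> dual d0])
  moreover have "continuous_on K \<tau>"
    unfolding \<tau>_def by (intro continuous_on_sum continuous_on_mult continuous_on_const
        continuous_on_subset[OF continuous_on_product_coordinates]) auto
  ultimately obtain w1 w2 where w1: "w1 \<in> K" "\<And>w. w \<in> K \<Longrightarrow> \<tau> w1 \<le> \<tau> w"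
    and w2: "w2 \<in> K" "\<And>w. w \<in> K \<Longrightarrow> \<tau> w \<le> \<tau> w2"
    using continuous_attains_inf[of K \<tau>] continuous_attains_sup[of K \<tau>] w0 by (metis empty_iff)
  \<comment> \<open>In a difference of two multipliers \<open>Gf x\<close> cancels, so
    \<open>rank_one\<close> applies to it.\<close>
  have Q_diff: "Q w d d - Q w' d d = (\<tau> w - \<tau> w') * \<rho> d" if "w \<in> K" "w' \<in> K" "d \<in> S" for w w' d
  proof -
    have "(\<Sum>i<N. (w i - w' i) *\<^sub>R Gc i x)
        = (Gf x + (\<Sum>i<N. w i *\<^sub>R Gc i x)) - (Gf x + (\<Sum>i<N. w' i *\<^sub>R Gc i x))"
      by (simp add: scaleR_diff_left sum_subtractf)
    also have "\<dots> = 0"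
      using that by (simp add: K_def)
    finally have "(\<Sum>i<N. (w i - w' i) * inner d (Hc i d)) = (\<Sum>i<N. (w i - w' i) * u i) * \<rho> d"
      using that(3) by (intro rank_one) (auto simp: S_def)
    then show ?thesis
      by (simp add: Q_def \<tau>_def left_diff_distrib sum_subtractf)
  qed
  have "linear Hf" "\<And>i. i < N \<Longrightarrow> linear (Hc i)"
    using Hf Hc by (auto intro: has_derivative_linear)
  then have bilinear: "bilinear (Q w)" for w
    unfolding bilinear_def Q_def
    by (auto intro!: linearI simp: linear_add linear_scale inner_add_left inner_add_right
        sum.distrib sum_distrib_left algebra_simps)
  have "\<exists>s\<in>{0..1}. \<forall>d\<in>S. 0 \<le> (1 - s) * Q w1 d d + s * Q w2 d d"
  proof (rule yuan_lemma[OF bilinear bilinear])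
    show "Real_Vector_Spaces.subspace S"
      unfolding S_def Real_Vector_Spaces.subspace_def by (auto simp: inner_add_right)
    fix d assume d: "d \<in> S"
    obtain w where w: "w \<in> K" "0 \<le> Q w d d"
      using ex_K[OF d Gf_S[OF d]] by auto
    \<comment> \<open>The sign of \<open>\<rho> d\<close> decides whether raising or lowering
      \<open>\<tau>\<close> increases the form at \<open>d\<close>.\<close>
    show "0 \<le> Q w1 d d \<or> 0 \<le> Q w2 d d"
    proof (cases "0 \<le> \<rho> d")
      case True
      then have "0 \<le> (\<tau> w2 - \<tau> w) * \<rho> d"
        using w2(2)[OF w(1)] by simp
      then show ?thesis
        using Q_diff[OF w2(1) w(1) d] w(2) by simp
    next
      case False
      then have "0 \<le> (\<tau> w1 - \<tau> w) * \<rho> d"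
        using w1(2)[OF w(1)] by (simp add: mult_nonpos_nonpos)
      then show ?thesis
        using Q_diff[OF w1(1) w(1) d] w(2) by simp
    qed
  qed
  then obtain s where s: "0 \<le> s" "s \<le> 1" "\<And>d. d \<in> S \<Longrightarrow> 0 \<le> (1 - s) * Q w1 d d + s * Q w2 d d"
    by auto
  \<comment> \<open>The conditions of \<open>K\<close> are preserved by convex combination, and
    \<open>Q\<close> is affine in the multiplier.\<close>
  define w where "w i = (1 - s) * w1 i + s * w2 i" for i
  have comb: "(\<Sum>i<N. w i *\<^sub>R Gc i x) = (1 - s) *\<^sub>R (\<Sum>i<N. w1 i *\<^sub>R Gc i x) + s *\<^sub>R (\<Sum>i<N. w2 i *\<^sub>R Gc i x)"
    by (simp add: w_def scaleR_add_left sum.distrib scaleR_sum_right)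
  have w12: "(\<Sum>i<N. w1 i *\<^sub>R Gc i x) = - Gf x" "(\<Sum>i<N. w2 i *\<^sub>R Gc i x) = - Gf x"
    using w1(1) w2(1) by (simp_all add: K_def add_eq_0_iff)
  have "Gf x + (\<Sum>i<N. w i *\<^sub>R Gc i x) = 0"
    unfolding comb w12 by (simp add: algebra_simps)
  moreover have "\<forall>i\<in>{m..<N}. 0 \<le> w i"
    using w1(1) w2(1) s by (auto simp: w_def K_def)
  moreover have "0 \<le> inner d (Hf d) + (\<Sum>i<N. w i * inner d (Hc i d))" if "\<forall>i<N. inner (Gc i x) d = 0" for d
  proof -
    have "(1 - s) * Q w1 d d + s * Q w2 d d = Q w d d"
      by (simp add: Q_def w_def algebra_simps sum.distrib sum_distrib_left sum_subtractf)
    then show ?thesis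
      using s(3)[of d] that by (simp add: S_def Q_def)
  qed
  ultimately show ?thesis
    by blast
qed

section \<open>Gradients, Hessians and dual families\<close>

text \<open>A linear functional is the inner product with \<open>adjoint F' 1\<close>, and only with
  this vector, so the description in \<open>grad\<close> denotes it.\<close>

lemma gderiv_grad:
  assumes "F differentiable (at x)"
  shows "GDERIV F x :> grad F x"
proof -
  obtain F' where F': "(F has_derivative F') (at x)"
    using assms by (auto simp: differentiable_def)
  then have "linear F'"
    by (rule has_derivative_linear)
  then have "F' = (\<lambda>h. inner h (adjoint F' 1))"
    by (simp add: adjoint_works fun_eq_iff)
  with F' have deriv: "GDERIV F x :> adjoint F' 1"
    unfolding gderiv_def by simp
  show ?thesis
    unfolding grad_def
  proof (rule theI[where P = "\<lambda>D. GDERIV F x :> D", OF deriv])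
    fix D assume "GDERIV F x :> D"
    from has_derivative_unique[OF this[unfolded gderiv_def] deriv[unfolded gderiv_def]]
    show "D = adjoint F' 1"
      by (metis vector_eq_ldot)
  qed
qed

lemma grad_eqI:
  assumes "GDERIV F x :> D"
  shows "grad F x = D"
proof -
  have "GDERIV F x :> grad F x"
    using assms by (intro gderiv_grad) (auto simp: gderiv_def differentiable_def)
  from has_derivative_unique[OF this[unfolded gderiv_def] assms[unfolded gderiv_def]]
  show ?thesis
    by (metis vector_eq_ldot)
qed

lemma hessian_vector_eqI:
  assumes "(grad F has_derivative H) (at x)"
  shows "hessian F x *v v = H v"
  using assms frechet_derivative_at[OF assms] has_derivative_linear[OF assms]
  by (simp add: hessian_def jacobian_def matrix_works)

lemma twice_cont_diff_gderiv: "twice_cont_diff F \<Longrightarrow> GDERIV F x :> grad F x"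
  by (intro gderiv_grad) (simp add: twice_cont_diff_def)

lemma twice_cont_diff_hessian:
  assumes "twice_cont_diff F"
  shows "(grad F has_derivative (\<lambda>v. hessian F x *v v)) (at x)"
  using assms unfolding twice_cont_diff_def hessian_def by (metis jacobian_works)

text \<open>The functional that is 1 at \<open>a k\<close> and 0 at the other vectors extends
  linearly from an independent set and is represented by a vector \<open>e k\<close>; injectivity
  lets \<open>k\<close> be recognized from \<open>a k\<close>.\<close>

lemma independent_imp_dual_family:
  fixes a :: "nat \<Rightarrow> 'a::euclidean_space"
  assumes "inj_on a {..<m}" "independent (a ` {..<m})"
  shows "\<exists>e. \<forall>i<m. \<forall>k<m. inner (a i) (e k) = (if i = k then 1 else 0)"
proof -
  have "\<exists>v. \<forall>i<m. inner (a i) v = (if i = k then 1 else 0)" if "k < m" for k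
  proof -
    obtain g :: "'a \<Rightarrow> real" where g: "linear g" "\<And>x. x \<in> a ` {..<m} \<Longrightarrow> g x = (if x = a k then 1 else 0)"
      using linear_independent_extend[OF assms(2), of "\<lambda>x. if x = a k then 1 else 0"] by blast
    have "inner (a i) (adjoint g 1) = (if i = k then 1 else 0)" if "i < m" for i
      using g(2)[of "a i"] that \<open>k < m\<close> assms(1) by (auto simp: adjoint_works[OF g(1)] inj_on_def)
    then show ?thesis by blast
  qed
  then show ?thesis by metis
qed

lemma sum_lessThan_add:
  fixes F :: "nat \<Rightarrow> 'a::comm_monoid_add"
  shows "(\<Sum>i<m + k. F i) = (\<Sum>i<m. F i) + (\<Sum>i<k. F (m + i))"
  by (induction k) (auto simp: add_ac)

theorem theorem3p2:
  fixes f :: "real ^ 'n \<Rightarrow> real"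
    and h g :: "nat \<Rightarrow> real ^ 'n \<Rightarrow> real"
    and m p :: nat
    and xs :: "real ^ 'n"
  defines "A \<equiv> active_set p g xs"
  defines "J \<equiv> constraint_jacobian m A h g"
  assumes f_C2: "twice_cont_diff f"
    and h_C2: "\<And>i. i < m \<Longrightarrow> twice_cont_diff (h i)"
    and g_C2: "\<And>j. j < p \<Longrightarrow> twice_cont_diff (g j)"
    and local_min: "local_minimizer_on f (feasible_set m p h g) xs"
    and mfcq: "MFCQ m p h g xs"
    and rank_le: "\<forall>\<^sub>F x in nhds xs. mat_rank (J x) \<le> mat_rank (J xs) + 1"
    and svd: "smooth_svd (m + card A) CARD('n) J xs"
  shows "\<exists>(lam, mu) \<in> lagrange_multipliers m p f h g xs.
           \<forall>d \<in> critical_subspace m p h g xs.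
             0 \<le> inner d (hessian (lagrangian m p f h g lam mu) xs *v d)"
proof -

  \<comment> \<open>Equality and active inequality constraints as one family\<close>
  have A: "finite A" "A \<subseteq> {..<p}"
    unfolding A_def active_set_def by auto
  define N where "N = m + card A"
  define L where "L = sorted_list_of_set A"
  \<comment> \<open>The order is that of the rows of \<open>J\<close>: equalities first, then active
    inequalities shifted by \<open>m\<close>.\<close>
  define c where "c i = (if i < m then h i else g (L ! (i - m)))" for i
  have L: "bij_betw (\<lambda>i. L ! i) {..<card A} A"
    unfolding L_def using A(1) bij_betw_nth[of "sorted_list_of_set A" "{..<card A}" A]
    by simp
  have L_A: "L ! (i - m) \<in> A" if "i \<in> {m..<N}" for i
    using that bij_betwE[OF L] by (auto simp: N_def)
  have A_L: "\<exists>i\<in>{m..<N}. j = L ! (i - m)" if "j \<in> A" for j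
  proof -
    have "j \<in> (\<lambda>i. L ! i) ` {..<card A}"
      using that bij_betw_imp_surj_on[OF L] by simp
    then obtain i where "j = L ! i" "i \<in> {..<card A}"
      by (rule imageE)
    then show ?thesis
      by (intro bexI[of _ "m + i"]) (auto simp: N_def)
  qed
  have c_less: "c i = h i" if "i < m" for i
    using that by (simp add: c_def)
  have c_ge: "c i = g (L ! (i - m))" if "i \<in> {m..<N}" for i
    using that by (simp add: c_def)
  have c_C2: "twice_cont_diff (c i)" if "i < N" for i
    using that h_C2 g_C2 L_A[of i] A(2) by (cases "i < m") (auto simp: c_def)
  have all_c: "(\<forall>i<N. P (c i)) \<longleftrightarrow> (\<forall>i<m. P (h i)) \<and> (\<forall>j\<in>A. P (g j))" for P
  proof (intro iffI conjI allI impI ballI)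
    fix i assume "\<forall>i<N. P (c i)" "i < m"
    then show "P (h i)"
      by (metis N_def c_less trans_less_add1)
  next
    fix j assume P: "\<forall>i<N. P (c i)" and "j \<in> A"
    then obtain i where i: "i \<in> {m..<N}" "j = L ! (i - m)"
      using A_L by metis
    then show "P (g j)"
      using P[rule_format, of i] c_ge[OF i(1)] by simp
  next
    fix i assume *: "(\<forall>i<m. P (h i)) \<and> (\<forall>j\<in>A. P (g j))" and "i < N"
    then show "P (c i)"
      using L_A[of i] by (cases "i < m") (simp_all add: c_def)
  qed
  have feas: "xs \<in> feasible_set m p h g"
    using mfcq by (simp add: MFCQ_def)
  have zero: "\<forall>i<N. c i xs = 0"
    unfolding all_c[of "\<lambda>F. F xs = 0"] using feas by (auto simp: feasible_set_def A_def active_set_def)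
  \<comment> \<open>By continuity these constraints stay negative near \<open>xs\<close>, so the
    family \<open>c\<close> alone ensures feasibility there.\<close>
  have inactive: "\<forall>\<^sub>F y in nhds xs. \<forall>j\<in>{..<p} - A. g j y < 0"
  proof (rule eventually_ball_finite, safe)
    fix j assume j: "j < p" "j \<notin> A"
    have "isCont (g j) xs"
      using twice_cont_diff_gderiv[OF g_C2[OF j(1)]] unfolding gderiv_def by (rule has_derivative_continuous)
    then have "(g j \<longlongrightarrow> g j xs) (nhds xs)"
      by (simp add: continuous_at tendsto_nhds_iff)
    moreover have "g j xs < 0"
      using j feas by (auto simp: feasible_set_def A_def active_set_def order_less_le)
    ultimately show "\<forall>\<^sub>F y in nhds xs. g j y < 0"
      by (rule order_tendstoD(2))
  qed simp
  have min: "\<forall>\<^sub>F y in nhds xs. (\<forall>i<m. c i y = 0) \<longrightarrow> (\<forall>i\<in>{m..<N}. c i y \<le> 0) \<longrightarrow> f xs \<le> f y"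
    using conjunct2[OF local_min[unfolded local_minimizer_on_def]] inactive
  proof eventually_elim
    case (elim y)
    show ?case
    proof (intro impI)
      assume eq: "\<forall>i<m. c i y = 0" and le: "\<forall>i\<in>{m..<N}. c i y \<le> 0"
      have "g j y \<le> 0" if "j < p" for j
      proof (cases "j \<in> A")
        case True
        then obtain i where "i \<in> {m..<N}" "j = L ! (i - m)"
          using A_L by metis
        then show ?thesis
          using le[rule_format, of i] c_ge[of i] by simp
      next
        case False
        then have "g j y < 0"
          using elim(2) that by auto
        then show ?thesis by simp
      qed
      then show "f xs \<le> f y"
        using eq elim(1) by (auto simp: feasible_set_def c_less)
    qed
  qed

  \<comment> \<open>Constraint qualification and the rank-one relation\<close>
  obtain e where "\<forall>i<m. \<forall>k<m. inner (grad (h i) xs) (e k) = (if i = k then 1 else 0)"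
    using independent_imp_dual_family[of "\<lambda>i. grad (h i) xs" m] mfcq unfolding MFCQ_def by blast
  then have dual: "inner (grad (c i) xs) (e k) = (if i = k then 1 else 0)" if "i < m" "k < m" for i k
    using that by (simp add: c_less)
  obtain d0 where "\<forall>i<m. inner (grad (h i) xs) d0 = 0" "\<forall>j\<in>A. inner (grad (g j) xs) d0 < 0"
    using mfcq unfolding MFCQ_def A_def by blast
  then have d0: "i < m \<Longrightarrow> inner (grad (c i) xs) d0 = 0"
    "i \<in> {m..<N} \<Longrightarrow> inner (grad (c i) xs) d0 < 0" for i
    using L_A c_ge by (simp_all add: c_less)
  let ?idx = "from_nat_into (UNIV :: 'n set)"
  \<comment> \<open>\<open>?idx\<close> numbers the coordinates like the columns of
    \<open>J\<close>, which turns sums over columns into inner products.\<close>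
  have sum_idx: "(\<Sum>k<CARD('n). F (?idx k)) = (\<Sum>j\<in>UNIV. F j)" for F :: "'n \<Rightarrow> real"
    using bij_betw_from_nat_into_finite[of "UNIV :: 'n set"] by (intro sum.reindex_bij_betw) simp
  have J_entry: "J y $$ (i, k) = grad (c i) y $ ?idx k" if "i < N" "k < CARD('n)" for y i k
    using that unfolding J_def constraint_jacobian_def by (simp add: N_def c_def L_def)
  obtain u \<rho> where u\<rho>: "\<And>w b J' v.
    \<lbrakk>\<forall>k<CARD('n). (\<Sum>i<N. w i * J xs $$ (i, k)) = 0;
     \<forall>i<N. (\<Sum>k<CARD('n). J xs $$ (i, k) * b k) = 0;
     \<forall>i<N. \<forall>k<CARD('n). ((\<lambda>y. J y $$ (i, k)) has_derivative J' i k) (at xs)\<rbrakk> \<Longrightarrow>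
    (\<Sum>i<N. \<Sum>k<CARD('n). w i * J' i k v * b k) = (\<Sum>i<N. w i * u i) * \<rho> v b"
    using smooth_svd_derivative_rank_one[OF svd rank_le] unfolding N_def by blast
  \<comment> \<open>The derivative of \<open>J\<close> in direction \<open>d\<close>, contracted
    with \<open>w\<close> on the left and \<open>d\<close> on the right, is the weighted sum of the
    quadratic forms of the constraint Hessians.\<close>
  have rank_one: "(\<Sum>i<N. w i * inner d (hessian (c i) xs *v d)) = (\<Sum>i<N. w i * u i) * \<rho> d (\<lambda>k. d $ ?idx k)"
    if w: "(\<Sum>i<N. w i *\<^sub>R grad (c i) xs) = 0" and d: "\<And>i. i < N \<Longrightarrow> inner (grad (c i) xs) d = 0" for w d
  proof -
    have "(\<Sum>i<N. w i * J xs $$ (i, k)) = 0" if "k < CARD('n)" for k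
      using arg_cong[OF w, of "\<lambda>v. v $ ?idx k"] that by (simp add: J_entry)
    moreover have "(\<Sum>k<CARD('n). J xs $$ (i, k) * d $ ?idx k) = 0" if "i < N" for i
      using d[OF that] sum_idx[of "\<lambda>j. grad (c i) xs $ j * d $ j"] that
      by (simp add: J_entry inner_vec_def)
    moreover have "((\<lambda>y. J y $$ (i, k)) has_derivative (\<lambda>v. (hessian (c i) xs *v v) $ ?idx k)) (at xs)"
      if "i < N" "k < CARD('n)" for i k
      unfolding J_entry[OF that]
      by (rule bounded_linear.has_derivative[OF bounded_linear_vec_nth
            twice_cont_diff_hessian[OF c_C2[OF that(1)]]])
    ultimately have "(\<Sum>i<N. \<Sum>k<CARD('n). w i * (hessian (c i) xs *v d) $ ?idx k * d $ ?idx k)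
        = (\<Sum>i<N. w i * u i) * \<rho> d (\<lambda>k. d $ ?idx k)"
      by (intro u\<rho>) simp_all
    moreover have "(\<Sum>k<CARD('n). w i * (hessian (c i) xs *v d) $ ?idx k * d $ ?idx k)
        = w i * inner d (hessian (c i) xs *v d)" for i
      using sum_idx[of "\<lambda>j. w i * (hessian (c i) xs *v d) $ j * d $ j"]
      by (simp add: inner_vec_def sum_distrib_left ac_simps)
    ultimately show ?thesis
      by simp
  qed
  from weak_second_order_condition[where f = f and c = c and x = xs and m = m and N = N and Gf = "grad f"
      and Gc = "\<lambda>i. grad (c i)" and Hf = "\<lambda>v. hessian f xs *v v" and Hc = "\<lambda>i v. hessian (c i) xs *v v",
      OF _ twice_cont_diff_gderiv[OF f_C2] twice_cont_diff_hessian[OF f_C2] twice_cont_diff_gderiv[OF c_C2]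
      twice_cont_diff_hessian[OF c_C2] zero[rule_format] min dual d0 rank_one]
  obtain w where w: "\<forall>i\<in>{m..<N}. 0 \<le> w i" "grad f xs + (\<Sum>i<N. w i *\<^sub>R grad (c i) xs) = 0"
    "\<And>d. \<forall>i<N. inner (grad (c i) xs) d = 0 \<Longrightarrow>
      0 \<le> inner d (hessian f xs *v d) + (\<Sum>i<N. w i * inner d (hessian (c i) xs *v d))"
    by (auto simp: N_def)

  \<comment> \<open>Multipliers and Lagrangian of the original problem\<close>
  define lam where "lam i = w i" for i
  \<comment> \<open>Inverting the enumeration \<open>L\<close> finds the position of
    \<open>j\<close> in the merged family. The default 0 off \<open>A\<close> gives complementarity
    and removes inactive constraints from the Lagrangian.\<close>
  define mu where "mu j = (if j \<in> A then w (m + the_inv_into {..<card A} (\<lambda>i. L ! i) j) else 0)" for j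
  have mu_L: "mu (L ! i) = w (m + i)" if "i < card A" for i
    using that L bij_betwE[OF L] by (simp add: mu_def the_inv_into_f_f bij_betw_imp_inj_on)
  have "lagrangian m p f h g lam mu y = f y + (\<Sum>i<N. w i * c i y)" for y
  proof -
    have "(\<Sum>j<p. mu j * g j y) = (\<Sum>j\<in>A. mu j * g j y)"
      using A(2) by (intro sum.mono_neutral_right) (auto simp: mu_def)
    also have "\<dots> = (\<Sum>i<card A. w (m + i) * c (m + i) y)"
      by (subst sum.reindex_bij_betw[OF L, symmetric]) (simp add: mu_L c_def)
    finally show ?thesis
      unfolding lagrangian_def N_def sum_lessThan_add by (simp add: lam_def c_less)
  qed
  then have lagr: "lagrangian m p f h g lam mu = (\<lambda>y. f y + (\<Sum>i<N. w i * c i y))"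
    by blast
  have grad_lagr: "grad (lagrangian m p f h g lam mu) y = grad f y + (\<Sum>i<N. w i *\<^sub>R grad (c i) y)" for y
    unfolding lagr gderiv_def
    by (rule grad_eqI) (auto simp: gderiv_def inner_add_right inner_sum_right
        intro!: has_derivative_add has_derivative_sum has_derivative_mult_right
          twice_cont_diff_gderiv[OF f_C2, unfolded gderiv_def]
          twice_cont_diff_gderiv[OF c_C2, unfolded gderiv_def])
  have hess_lagr: "hessian (lagrangian m p f h g lam mu) xs *v d
      = hessian f xs *v d + (\<Sum>i<N. w i *\<^sub>R (hessian (c i) xs *v d))" for d
  proof (rule hessian_vector_eqI)
    show "(grad (lagrangian m p f h g lam mu) has_derivative
        (\<lambda>d. hessian f xs *v d + (\<Sum>i<N. w i *\<^sub>R (hessian (c i) xs *v d)))) (at xs)"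
      unfolding grad_lagr[abs_def]
      by (intro has_derivative_add has_derivative_sum has_derivative_scaleR_right
          twice_cont_diff_hessian f_C2 c_C2) auto
  qed
  have "0 \<le> mu j" for j
  proof (cases "j \<in> A")
    case True
    then obtain i where "i \<in> {m..<N}" "j = L ! (i - m)"
      using A_L by metis
    then show ?thesis
      using w(1) mu_L[of "i - m"] by (auto simp: N_def)
  qed (simp add: mu_def)
  moreover have "mu j * g j xs = 0" for j
    by (simp add: mu_def A_def active_set_def)
  ultimately have "(lam, mu) \<in> lagrange_multipliers m p f h g xs"
    using w(2) by (simp add: lagrange_multipliers_def grad_lagr)
  moreover have "0 \<le> inner d (hessian (lagrangian m p f h g lam mu) xs *v d)"
    if "d \<in> critical_subspace m p h g xs" for d
  proof -
    have "\<forall>i<N. inner (grad (c i) xs) d = 0"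
      unfolding all_c[of "\<lambda>F. inner (grad F xs) d = 0"]
      using that by (simp add: critical_subspace_def A_def)
    then show ?thesis
      using w(3) by (simp add: hess_lagr inner_add_right inner_sum_right)
  qed
  ultimately show ?thesis
    by blast
qed

end
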